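(* Let $X$ be a separable Banach space such that every spreading model of a normalized weakly null sequence in $X$ is equivalent to the unit vector basis of $c_0$. Then $X$ is weakly asymptotically symmetric.
   Context: A sequence $(\tilde x_i)$ (in some normed space) is a spreading model of a normalized basic sequence $(x_i)$ if for all $\varepsilon>0$ and $k\in\mathbb{N}$ there exists $n\in\mathbb{N}$ so that for all $n\le n_1<\cdots<n_k$ and all scalars $(a_i)_{i=1}^k$ with each $|a_i|\le 1$, $$\Big|\,\Big\|\sum_{i=1}^k a_ix_{n_i}\Big\|-\Big\|\sum_{i=1}^k a_i\tilde x_i\Big\|\,\Big|<\varepsilon.$$ Two sequences $(x_i)$ and $(y_i)$ are equivalent if there are $A,B\in(0,\infty)$ such that $A^{-1}\|\sum a_iy_i\|\le\|\sum a_ix_i\|\le B\|\sum a_iy_i\|$ for all finitely supported scalar sequences $(a_i)$ (the constants are not assumed uniform over the different spreading models). $X$ is weakly asymptotically symmetric if there is $C<\infty$ such that for all $m\in\mathbb{N}$, all weakly null sequences $(x_n^i)_{n=1}^\infty\subseteq X$, $1\le i\le m$, and all permutations $\sigma$ of $\{1,\ldots,m\}$, $$\lim_{n_1\to\infty}\cdots\lim_{n_m\to\infty}\Big\|\sum_{i=1}^m x_{n_i}^i\Big\|\le C\lim_{n_{\sigma(1)}\to\infty}\cdots\lim_{n_{\sigma(m)}\to\infty}\Big\|\sum_{i=1}^m x_{n_i}^i\Big\|,$$ provided that these iterated limits exist. *)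

theory Defs
  imports "HOL-Analysis.Analysis"
begin

text \<open>Scalars are real. Sequences are indexed from 0.\<close>

definition weakly_null :: "(nat \<Rightarrow> 'a::real_normed_vector) \<Rightarrow> bool" where
  "weakly_null x \<longleftrightarrow> (\<forall>f::'a \<Rightarrow> real. bounded_linear f \<longrightarrow> (\<lambda>n. f (x n)) \<longlonglongrightarrow> 0)"

definition normalized :: "(nat \<Rightarrow> 'a::real_normed_vector) \<Rightarrow> bool" where
  "normalized x \<longleftrightarrow> (\<forall>n. norm (x n) = 1)"

text \<open>A basic sequence is a Schauder basis of its closed linear span.\<close>

definition basic_sequence :: "(nat \<Rightarrow> 'a::real_normed_vector) \<Rightarrow> bool" where
  "basic_sequence x \<longleftrightarrow>
     (\<forall>v \<in> closure (span (range x)). \<exists>!a::nat \<Rightarrow> real. (\<lambda>n. a n *\<^sub>R x n) sums v)"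

definition spreading_model ::
    "(nat \<Rightarrow> 'b::real_normed_vector) \<Rightarrow> (nat \<Rightarrow> 'a::real_normed_vector) \<Rightarrow> bool" where
  "spreading_model xt x \<longleftrightarrow> normalized x \<and> basic_sequence x \<and>
     (\<forall>\<epsilon>>0. \<forall>k. \<exists>N. \<forall>n::nat \<Rightarrow> nat.
        strict_mono_on {..<k} n \<and> (\<forall>i<k. N \<le> n i) \<longrightarrow>
        (\<forall>a::nat \<Rightarrow> real. (\<forall>i<k. \<bar>a i\<bar> \<le> 1) \<longrightarrow>
           \<bar>norm (\<Sum>i<k. a i *\<^sub>R x (n i)) - norm (\<Sum>i<k. a i *\<^sub>R xt i)\<bar> < \<epsilon>))"

definition equivalent_sequences ::
    "(nat \<Rightarrow> 'a::real_normed_vector) \<Rightarrow> (nat \<Rightarrow> 'b::real_normed_vector) \<Rightarrow> bool" where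
  "equivalent_sequences x y \<longleftrightarrow>
     (\<exists>A>0. \<exists>B>0. \<forall>a::nat \<Rightarrow> real. finite {i. a i \<noteq> 0} \<longrightarrow>
        inverse A * norm (\<Sum>i | a i \<noteq> 0. a i *\<^sub>R y i) \<le> norm (\<Sum>i | a i \<noteq> 0. a i *\<^sub>R x i) \<and>
        norm (\<Sum>i | a i \<noteq> 0. a i *\<^sub>R x i) \<le> B * norm (\<Sum>i | a i \<noteq> 0. a i *\<^sub>R y i))"

text \<open>
  The type of bounded (automatically continuous) functions on the discrete space of naturals,
  with the supremum norm, is the Banach space \<open>\<ell>\<^sup>\<infinity>\<close>. It serves two purposes.

  First, \<open>c\<^sub>0\<close> is its closed subspace of null sequences, so the unit vector basis
  of \<open>c\<^sub>0\<close> lives in it.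

  Second, a spreading model may live in an arbitrary normed space, and HOL cannot quantify over
  types inside a formula. A sequence in a normed space spans a separable subspace, and
  every separable normed space embeds linearly and isometrically into \<open>\<ell>\<^sup>\<infinity>\<close>; being a
  spreading model of a given sequence and being equivalent to a given sequence are invariant
  under such embeddings. Hence quantifying over all sequences in \<open>\<ell>\<^sup>\<infinity>\<close> covers spreading
  models in all normed spaces.
\<close>

type_synonym l_infinity = "nat \<Rightarrow>\<^sub>C real"

definition c0_unit :: "nat \<Rightarrow> l_infinity" where
  "c0_unit i = Bcontfun (\<lambda>j. if j = i then 1 else 0)"

lemma apply_c0_unit: "apply_bcontfun (c0_unit i) j = (if j = i then 1 else 0)"
proof -
  have "bounded (range (\<lambda>j::nat. if j = i then 1 else (0::real)))"
    by (rule boundedI[where B = 1]) auto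
  then have "(\<lambda>j. if j = i then 1 else (0::real)) \<in> bcontfun"
    by (simp add: bcontfun_def)
  then show ?thesis
    by (simp add: c0_unit_def Bcontfun_inverse)
qed

text \<open>
  \<open>has_iterated_lim F [s\<^sub>1, \<dots>, s\<^sub>m] n L\<close> says that the iterated limit of \<open>F\<close>, with
  \<open>n s\<^sub>1 \<rightarrow> \<infinity>\<close> outermost and \<open>n s\<^sub>m \<rightarrow> \<infinity>\<close> innermost, exists and equals \<open>L\<close>; coordinates
  of \<open>n\<close> not in the list are held fixed. As for any limit of a sequence, the inner limits
  need to exist only for all sufficiently large values of the outer index.
\<close>

primrec has_iterated_lim ::
    "((nat \<Rightarrow> nat) \<Rightarrow> real) \<Rightarrow> nat list \<Rightarrow> (nat \<Rightarrow> nat) \<Rightarrow> real \<Rightarrow> bool" where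
  "has_iterated_lim F [] n L \<longleftrightarrow> L = F n"
| "has_iterated_lim F (s # ss) n L \<longleftrightarrow>
     (\<exists>g::nat \<Rightarrow> real. (\<forall>\<^sub>F k in sequentially. has_iterated_lim F ss (n(s := k)) (g k))
        \<and> g \<longlonglongrightarrow> L)"

text \<open>
  The initial index assignment \<open>\<lambda>_. 0\<close> is irrelevant: the norm depends only on the coordinates
  below \<open>m\<close>, all of which are bound by the iterated limits.
\<close>

definition weakly_asymptotically_symmetric :: "'a::real_normed_vector itself \<Rightarrow> bool" where
  "weakly_asymptotically_symmetric (_ :: 'a itself) \<longleftrightarrow>
     (\<exists>C::real. \<forall>m. \<forall>x::nat \<Rightarrow> nat \<Rightarrow> 'a. \<forall>\<sigma> L R.
        (\<forall>i<m. weakly_null (x i)) \<longrightarrow> \<sigma> permutes {..<m} \<longrightarrow>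
        has_iterated_lim (\<lambda>n. norm (\<Sum>i<m. x i (n i))) [0..<m] (\<lambda>_. 0) L \<longrightarrow>
        has_iterated_lim (\<lambda>n. norm (\<Sum>i<m. x i (n i))) (map \<sigma> [0..<m]) (\<lambda>_. 0) R \<longrightarrow>
        L \<le> C * R)"

end

theory Submission
  imports Defs
begin

text \<open>
  Write \<open>R\<close> for the iterated limit of \<open>\<parallel>x\<^sub>1(n\<^sub>1) + \<dots> + x\<^sub>m(n\<^sub>m)\<parallel>\<close> in the order \<open>\<sigma>\<close> and \<open>L\<close> for the one in
  the natural order. The sum \<open>\<Sum> x\<^sub>j(n\<^sub>j)\<close> is to be compared with a single weakly null sequence,
  for which the hypothesis on spreading models gives upper \<open>c\<^sub>0\<close> estimates.

  Choose, for each \<open>N\<close>, indices \<open>\<phi>\<^sub>j(N) \<ge> N\<close> that follow the order \<open>\<sigma>\<close> and for which the sums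
  \<open>\<Sum> s\<^sub>j x\<^sub>j(\<phi>\<^sub>j(N))\<close> have norm at most \<open>2 R + \<epsilon>\<close>, for all signs \<open>s\<close> at once. This is possible because
  iterated norms of weakly null sequences are suppression unconditional
  (\<open>iter_norm_suppress\<close>): as functions of the base point they are convex and continuous, hence
  weakly lower semicontinuous. With \<open>z\<^sub>j(N) = x\<^sub>j(\<phi>\<^sub>j(N))\<close>, the sequences \<open>y\<^sub>s = \<Sum> s\<^sub>j z\<^sub>j\<close> are weakly null
  with norms at most \<open>2 R + \<epsilon>\<close>, so the iterated norm of \<open>s\<^sub>1 y\<^sub>s(n\<^sub>1) + \<dots> + s\<^sub>m y\<^sub>s(n\<^sub>m)\<close> is at most
  \<open>K (2 R + \<epsilon>)\<close>. Averaged over all signs, these vectors give the diagonal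
  \<open>z\<^sub>1(n\<^sub>1) + \<dots> + z\<^sub>m(n\<^sub>m)\<close>, because the average of \<open>s\<^sub>i s\<^sub>j\<close> vanishes for \<open>i \<noteq> j\<close>
  (\<open>iter_norm_diagonal_le\<close>). Replacing \<open>x\<^sub>j\<close> by \<open>z\<^sub>j\<close> does not change \<open>L\<close>, so
  \<open>L \<le> K (2 R + \<epsilon>)\<close>, and \<open>2 K\<close> is a constant of asymptotic symmetry.

  The constant \<open>K\<close> must not depend on the sequence, whereas the hypothesis gives a constant for each
  spreading model separately. For fixed coefficients \<open>a\<close> with \<open>\<bar>a\<^sub>i\<bar> \<le> 1\<close>, the iterated norm of
  \<open>a\<^sub>1 z(n\<^sub>1) + \<dots> + a\<^sub>k z(n\<^sub>k)\<close> is a continuous seminorm of \<open>z\<close> on the complete space of weakly null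
  sequences, so the uniform boundedness principle applies
  (\<open>weakly_null_sums_uniformly_bounded\<close>). The pointwise bound is where spreading models enter
  (\<open>spreading_subsequence_bound\<close>): every weakly null sequence whose norms do not tend to 0
  along the ultrafilter below has, after normalisation, a basic subsequence with a spreading model whose norm is the iterated norm.

  All limits are taken along one fixed free ultrafilter on the natural numbers. They exist for
  all bounded sequences, are linear, and agree with ordinary limits where those exist, so that seminorms
  can be formed on whole spaces of sequences without passing to subsequences.
\<close>

section \<open>Limits along a free ultrafilter\<close>

lemma exists_minimal_filter:
  "\<exists>F\<le>sequentially. F \<noteq> bot \<and> (\<forall>G\<le>F. G \<noteq> bot \<longrightarrow> G = F)"
proof -
  let ?A = "{F. F \<le> sequentially \<and> F \<noteq> bot}"
  have "\<exists>m\<in>?A. \<forall>a\<in>?A. a \<le> m \<longrightarrow> a = m"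
  proof (rule predicate_Zorn[where P = "\<lambda>F G. G \<le> F"])
    show "partial_order_on ?A (relation_of (\<lambda>F G. G \<le> F) ?A)"
      by (rule partial_order_on_relation_ofI) auto
    fix C assume C: "C \<in> Chains (relation_of (\<lambda>F G. G \<le> F) ?A)"
    then have sub: "C \<subseteq> ?A" and tot: "\<And>F G. F \<in> C \<Longrightarrow> G \<in> C \<Longrightarrow> F \<le> G \<or> G \<le> F"
      by (auto simp: Chains_def relation_of_def)
    show "\<exists>u\<in>?A. \<forall>a\<in>C. u \<le> a"
    proof (cases "C = {}")
      case True
      then show ?thesis by (auto intro!: exI[of _ sequentially])
    next
      case False
      have "eventually P (Inf C) \<longleftrightarrow> (\<exists>b\<in>C. eventually P b)" for P
      proof (rule eventually_Inf_base[OF False])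
        fix F G assume FG: "F \<in> C" "G \<in> C"
        from tot[OF FG] show "\<exists>x\<in>C. x \<le> inf F G"
        proof
          assume "F \<le> G"
          then show ?thesis using FG(1) by (intro bexI[of _ F] le_infI order_refl)
        next
          assume "G \<le> F"
          then show ?thesis using FG(2) by (intro bexI[of _ G] le_infI order_refl)
        qed
      qed
      note ev = this
      have "Inf C \<noteq> bot"
      proof
        assume "Inf C = bot"
        then have "eventually (\<lambda>_. False) (Inf C)" by (simp only: eventually_bot)
        with ev[of "\<lambda>_. False"] obtain b where b: "b \<in> C" "eventually (\<lambda>_. False) b"
          by blast
        from b(2) have "b = bot" by (simp only: eventually_False)
        moreover have "b \<in> ?A" by (rule subsetD[OF sub b(1)])
        ultimately show False by blast
      qed
      moreover have "Inf C \<le> sequentially"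
      proof -
        obtain b where b: "b \<in> C" using False by blast
        then have "b \<le> sequentially" using sub by blast
        then show ?thesis using Inf_lower[OF b] by (rule order_trans[rotated])
      qed
      ultimately show ?thesis
        by (auto intro: Inf_lower)
    qed
  qed
  then show ?thesis by auto
qed

text \<open>
  Minimality among the proper filters is the ultrafilter property, and lying below
  \<^term>\<open>sequentially\<close> makes the ultrafilter free.
\<close>

definition ultra :: "nat filter" where
  "ultra = (SOME F. F \<le> sequentially \<and> F \<noteq> bot \<and> (\<forall>G\<le>F. G \<noteq> bot \<longrightarrow> G = F))"

lemma ultra_props:
  shows ultra_le: "ultra \<le> sequentially" and ultra_nonbot [simp]: "ultra \<noteq> bot"
    and ultra_minimal: "\<And>G. G \<le> ultra \<Longrightarrow> G \<noteq> bot \<Longrightarrow> G = ultra"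
proof -
  have "ultra \<le> sequentially \<and> ultra \<noteq> bot \<and> (\<forall>G\<le>ultra. G \<noteq> bot \<longrightarrow> G = ultra)"
    unfolding ultra_def by (rule someI_ex) (use exists_minimal_filter in blast)
  then show "ultra \<le> sequentially" "ultra \<noteq> bot" "\<And>G. G \<le> ultra \<Longrightarrow> G \<noteq> bot \<Longrightarrow> G = ultra"
    by auto
qed

lemma eventually_ultra: "eventually P sequentially \<Longrightarrow> eventually P ultra"
  using ultra_le by (simp add: filter_leD)

lemma tendsto_ultra: "f \<longlonglongrightarrow> l \<Longrightarrow> (f \<longlongrightarrow> l) ultra"
  using ultra_le by (rule tendsto_mono)

lemma ultra_ex: "eventually P ultra \<Longrightarrow> \<exists>n. P n"
  using eventually_happens'[OF ultra_nonbot] .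

lemma ultra_dichotomy: "eventually P ultra \<or> eventually (\<lambda>n. \<not> P n) ultra"
proof (cases "inf ultra (principal {n. P n}) = bot")
  case True
  then have "eventually (\<lambda>_. False) (inf ultra (principal {n. P n}))" by simp
  then show ?thesis by (simp add: eventually_inf_principal)
next
  case False
  then have "inf ultra (principal {n. P n}) = ultra"
    by (intro ultra_minimal) auto
  then have "eventually P ultra \<longleftrightarrow> eventually P (inf ultra (principal {n. P n}))" by simp
  then show ?thesis by (auto simp: eventually_inf_principal)
qed

text \<open>
  A bounded real sequence has a cluster point along \<^term>\<open>ultra\<close> by compactness, and along an
  ultrafilter a cluster point is a limit.
\<close>

lemma ultra_lim:
  fixes f :: "nat \<Rightarrow> real"
  assumes "bounded (range f)"
  shows "(f \<longlongrightarrow> Lim ultra f) ultra"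
proof -
  let ?K = "closure (range f)"
  have "compact ?K" using assms by (simp add: compact_closure)
  moreover have "filtermap f ultra \<noteq> bot" by (simp add: filtermap_bot_iff)
  moreover have "eventually (\<lambda>y. y \<in> ?K) (filtermap f ultra)"
    by (auto simp: eventually_filtermap intro!: always_eventually closure_subset[THEN subsetD])
  ultimately obtain x where x: "inf (nhds x) (filtermap f ultra) \<noteq> bot"
    unfolding compact_filter by blast
  have "(f \<longlongrightarrow> x) ultra"
  proof (rule topological_tendstoI)
    fix S assume S: "open S" "x \<in> S"
    show "eventually (\<lambda>n. f n \<in> S) ultra"
    proof (rule ccontr)
      assume "\<not> ?thesis"
      then have "eventually (\<lambda>n. f n \<notin> S) ultra" using ultra_dichotomy by blast
      then have "eventually (\<lambda>y. y \<notin> S) (filtermap f ultra)"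
        by (simp add: eventually_filtermap)
      moreover have "eventually (\<lambda>y. y \<in> S) (nhds x)"
        using S by (auto simp: eventually_nhds)
      ultimately have "eventually (\<lambda>_. False) (inf (nhds x) (filtermap f ultra))"
        unfolding eventually_inf by blast
      then show False using x by simp
    qed
  qed
  then show ?thesis by (simp add: tendsto_Lim)
qed

lemma ultra_Lim_eq: "(f \<longlongrightarrow> l) ultra \<Longrightarrow> Lim ultra f = l"
  by (rule tendsto_Lim) simp

lemma ultra_limit_le:
  fixes f :: "nat \<Rightarrow> real"
  assumes "(f \<longlongrightarrow> a) ultra" "(g \<longlongrightarrow> b) ultra" "\<And>n. f n \<le> g n"
  shows "a \<le> b"
  using tendsto_le[OF ultra_nonbot assms(2,1)] assms(3) by simp

section \<open>Norming functionals\<close>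

definition sublinear :: "('a::real_vector \<Rightarrow> real) \<Rightarrow> bool" where
  "sublinear q \<longleftrightarrow> (\<forall>x y. q (x + y) \<le> q x + q y) \<and> (\<forall>c\<ge>0. \<forall>x. q (c *\<^sub>R x) = c * q x)"

lemma sublinear_zero: "sublinear q \<Longrightarrow> q 0 = 0"
  unfolding sublinear_def by (metis mult_zero_left order_refl scaleR_zero_left)

lemma sublinear_neg: "sublinear q \<Longrightarrow> - q (- x) \<le> q x"
proof -
  assume q: "sublinear q"
  then have "q (x + - x) \<le> q x + q (- x)" unfolding sublinear_def by blast
  then show ?thesis using sublinear_zero[OF q] by simp
qed

text \<open>
  The witness is the one-sided derivative of \<^term>\<open>q\<close> at \<^term>\<open>y\<close>, the infimum of
  \<open>q (x + t y) - t q y\<close> over \<open>t \<ge> 0\<close>. It is linear on the line through \<^term>\<open>y\<close>.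
\<close>

lemma sublinear_linearize_at:
  assumes q: "sublinear q"
  shows "\<exists>q'. sublinear q' \<and> q' \<le> q \<and> q' (- y) \<le> - q y"
proof -
  have add: "\<And>x y. q (x + y) \<le> q x + q y" and scale: "\<And>c x. c \<ge> 0 \<Longrightarrow> q (c *\<^sub>R x) = c * q x"
    using q by (auto simp: sublinear_def)
  define S where "S x = (\<lambda>t. q (x + t *\<^sub>R y) - t * q y) ` {0..}" for x
  define q' where "q' x = Inf (S x)" for x
  have low: "- q (- x) \<le> q (x + t *\<^sub>R y) - t * q y" if "t \<ge> 0" for x t
  proof -
    have "q (t *\<^sub>R y) \<le> q (x + t *\<^sub>R y) + q (- x)"
      using add[of "x + t *\<^sub>R y" "- x"] by simp
    then show ?thesis using scale[OF that, of y] by simp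
  qed
  then have bdd: "bdd_below (S x)" for x
    unfolding S_def by (intro bdd_belowI2[where m = "- q (- x)"]) auto
  have upper: "q' x \<le> q (x + t *\<^sub>R y) - t * q y" if "t \<ge> 0" for x t
    unfolding q'_def by (rule cInf_lower[OF _ bdd]) (use that in \<open>auto simp: S_def\<close>)
  have greatest: "b \<le> q' x" if "\<And>t. t \<ge> 0 \<Longrightarrow> b \<le> q (x + t *\<^sub>R y) - t * q y" for b x
    unfolding q'_def by (rule cInf_greatest) (use that in \<open>auto simp: S_def\<close>)
  have add': "q' (u + v) \<le> q' u + q' v" for u v
  proof -
    have "q' (u + v) - (q (v + s *\<^sub>R y) - s * q y) \<le> q' u" if s: "s \<ge> 0" for s
    proof (rule greatest)
      fix t :: real assume t: "t \<ge> 0"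
      have "q' (u + v) \<le> q (u + v + (s + t) *\<^sub>R y) - (s + t) * q y"
        using s t by (intro upper) auto
      also have "u + v + (s + t) *\<^sub>R y = (u + t *\<^sub>R y) + (v + s *\<^sub>R y)"
        by (simp add: algebra_simps)
      also have "q \<dots> \<le> q (u + t *\<^sub>R y) + q (v + s *\<^sub>R y)" by (rule add)
      finally show "q' (u + v) - (q (v + s *\<^sub>R y) - s * q y) \<le> q (u + t *\<^sub>R y) - t * q y"
        by (simp add: algebra_simps)
    qed
    then have "q' (u + v) - q' u \<le> q' v"
      by (intro greatest) (simp add: algebra_simps)
    then show ?thesis by simp
  qed
  have le_scale: "q' (c *\<^sub>R x) \<le> c * q' x" if c: "c > 0" for c x
  proof -
    have "inverse c * q' (c *\<^sub>R x) \<le> q' x"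
    proof (rule greatest)
      fix t :: real assume t: "t \<ge> 0"
      have "q' (c *\<^sub>R x) \<le> q (c *\<^sub>R x + (c * t) *\<^sub>R y) - (c * t) * q y"
        using t c by (intro upper) auto
      also have "c *\<^sub>R x + (c * t) *\<^sub>R y = c *\<^sub>R (x + t *\<^sub>R y)" by (simp add: algebra_simps)
      also have "q \<dots> = c * q (x + t *\<^sub>R y)" using c by (simp add: scale)
      finally show "inverse c * q' (c *\<^sub>R x) \<le> q (x + t *\<^sub>R y) - t * q y"
        using c by (simp add: field_simps)
    qed
    then show ?thesis using c by (simp add: field_simps)
  qed
  have "q' (c *\<^sub>R x) = c * q' x" if c: "c \<ge> 0" for c x
  proof (cases "c = 0")
    case True
    have "q' 0 \<le> 0" using upper[of 0 0] sublinear_zero[OF q] by simp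
    moreover have "0 \<le> q' 0" by (rule greatest) (simp add: scale)
    ultimately show ?thesis using True by simp
  next
    case False
    then have c': "c > 0" using c by simp
    have "q' x \<le> inverse c * q' (c *\<^sub>R x)"
      using le_scale[of "inverse c" "c *\<^sub>R x"] c' by simp
    then have "c * q' x \<le> q' (c *\<^sub>R x)" using c' by (simp add: field_simps)
    then show ?thesis using le_scale[OF c'] by (simp add: antisym)
  qed
  moreover have "q' \<le> q" using upper[of 0] by (simp add: le_fun_def)
  moreover have "q' (- y) \<le> - q y" using upper[of 1 "- y"] sublinear_zero[OF q] by simp
  ultimately show ?thesis using add' unfolding sublinear_def by blast
qed

text \<open>
  A minimal sublinear function coincides with each of its linearizations, hence is odd, and an odd
  sublinear function is linear.
\<close>

lemma sublinear_dominates_linear: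
  assumes p: "sublinear p"
  shows "\<exists>f. linear f \<and> (\<forall>x. f x \<le> p x)"
proof -
  let ?A = "{q. sublinear q \<and> q \<le> p}"
  have "\<exists>m\<in>?A. \<forall>a\<in>?A. a \<le> m \<longrightarrow> a = m"
  proof (rule predicate_Zorn[where P = "\<lambda>F G. G \<le> F"])
    show "partial_order_on ?A (relation_of (\<lambda>F G. G \<le> F) ?A)"
      by (rule partial_order_on_relation_ofI) auto
    fix C assume C: "C \<in> Chains (relation_of (\<lambda>F G. G \<le> F) ?A)"
    then have sub: "C \<subseteq> ?A" and tot: "\<And>F G. F \<in> C \<Longrightarrow> G \<in> C \<Longrightarrow> F \<le> G \<or> G \<le> F"
      by (auto simp: Chains_def relation_of_def)
    show "\<exists>u\<in>?A. \<forall>a\<in>C. u \<le> a"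
    proof (cases "C = {}")
      case True
      then show ?thesis using p by auto
    next
      case False
      define r where "r x = (INF q\<in>C. q x)" for x
      have "- p (- x) \<le> q x" if "q \<in> C" for q x
      proof -
        have "sublinear q" "q \<le> p" using sub that by auto
        then show ?thesis using sublinear_neg[of q x] by (auto simp: le_fun_def intro: order_trans[rotated])
      qed
      then have bdd: "bdd_below ((\<lambda>q. q x) ` C)" for x
        by (intro bdd_belowI2[where m = "- p (- x)"])
      have upper: "r x \<le> q x" if "q \<in> C" for q x
        unfolding r_def by (rule cINF_lower[OF bdd that])
      have greatest: "b \<le> r x" if "\<And>q. q \<in> C \<Longrightarrow> b \<le> q x" for b x
        unfolding r_def by (rule cINF_greatest[OF False that])
      have sl: "sublinear q" if "q \<in> C" for q using sub that by auto
      have add: "r (x + y) \<le> r x + r y" for x y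
      proof -
        have "r (x + y) - q' y \<le> q x" if qq: "q \<in> C" "q' \<in> C" for q q'
        proof -
          obtain s where s: "s \<in> C" "s \<le> q" "s \<le> q'"
            using tot[OF qq] qq order_refl by metis
          have "r (x + y) \<le> s x + s y"
            using upper[OF s(1), of "x + y"] sl[OF s(1)] unfolding sublinear_def by (meson order_trans)
          also have "\<dots> \<le> q x + q' y" using s by (intro add_mono) (auto simp: le_fun_def)
          finally show ?thesis by simp
        qed
        then have "r (x + y) - q' y \<le> r x" if "q' \<in> C" for q'
          using that by (intro greatest) auto
        then have "r (x + y) - r x \<le> r y"
          by (intro greatest) (simp add: algebra_simps)
        then show ?thesis by simp
      qed
      have "r (c *\<^sub>R x) = c * r x" if c: "c \<ge> 0" for c x
      proof (rule antisym)
        show "c * r x \<le> r (c *\<^sub>R x)"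
        proof (rule greatest)
          fix q assume q: "q \<in> C"
          show "c * r x \<le> q (c *\<^sub>R x)"
            using sl[OF q] c mult_left_mono[OF upper[OF q, of x] c] by (simp add: sublinear_def)
        qed
        show "r (c *\<^sub>R x) \<le> c * r x"
        proof (cases "c = 0")
          case True
          obtain q where "q \<in> C" using False by auto
          then show ?thesis using upper[of q 0] sublinear_zero[OF sl, of q] True by simp
        next
          case False
          then have c': "c > 0" using c by simp
          have "inverse c * r (c *\<^sub>R x) \<le> r x"
          proof (rule greatest)
            fix q assume q: "q \<in> C"
            have "r (c *\<^sub>R x) \<le> c * q x"
              using upper[OF q, of "c *\<^sub>R x"] sl[OF q] c by (simp add: sublinear_def)
            then show "inverse c * r (c *\<^sub>R x) \<le> q x" using c' by (simp add: field_simps)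
          qed
          then show ?thesis using c' by (simp add: field_simps)
        qed
      qed
      with add have "sublinear r" by (auto simp: sublinear_def)
      moreover have "r \<le> p"
      proof (rule le_funI)
        fix x
        obtain q where q: "q \<in> C" using False by blast
        then have "q \<le> p" using sub by blast
        then show "r x \<le> p x" using upper[OF q, of x] by (auto simp: le_fun_def intro: order_trans)
      qed
      ultimately show ?thesis using upper by (auto simp: le_fun_def)
    qed
  qed
  then obtain q where q: "sublinear q" "q \<le> p"
    and min: "\<And>a. sublinear a \<Longrightarrow> a \<le> p \<Longrightarrow> a \<le> q \<Longrightarrow> a = q" by blast
  have odd: "q (- y) = - q y" for y
  proof -
    obtain q' where q': "sublinear q'" "q' \<le> q" "q' (- y) \<le> - q y"
      using sublinear_linearize_at[OF q(1)] by blast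
    then have "q' = q" using min q(2) by (meson order_trans)
    then show ?thesis using q'(3) sublinear_neg[OF q(1), of "- y"] by simp
  qed
  have sub: "\<And>x y. q (x + y) \<le> q x + q y" and scale: "\<And>c x. c \<ge> 0 \<Longrightarrow> q (c *\<^sub>R x) = c * q x"
    using q by (auto simp: sublinear_def)
  have "linear q"
  proof (rule linearI)
    fix x y
    show "q (x + y) = q x + q y"
      using sub[of x y] sub[of "- x" "- y"] odd[of x] odd[of y] odd[of "x + y"] by simp
  next
    fix c :: real and x
    show "q (c *\<^sub>R x) = c *\<^sub>R q x"
    proof (cases "c \<ge> 0")
      case False
      then show ?thesis using scale[of "- c" x] odd[of "c *\<^sub>R x"] by simp
    qed (simp add: scale)
  qed
  then show ?thesis using q(2) by (auto simp: le_fun_def)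
qed

definition contraction_functional :: "('a::real_normed_vector \<Rightarrow> real) \<Rightarrow> bool" where
  "contraction_functional f \<longleftrightarrow> linear f \<and> (\<forall>x. \<bar>f x\<bar> \<le> norm x)"

lemma contraction_functional_bounded_linear:
  "contraction_functional f \<Longrightarrow> bounded_linear f"
  unfolding contraction_functional_def
  by (auto simp: bounded_linear_def bounded_linear_axioms_def intro!: exI[of _ 1])

text \<open>
  Linearize the norm at \<^term>\<open>v\<close> before passing to a linear function below it: this forces the value
  at \<^term>\<open>v\<close>.
\<close>

lemma norming_functional:
  fixes v :: "'a::real_normed_vector"
  shows "\<exists>f. contraction_functional f \<and> f v = norm v"
proof -
  have "sublinear (norm :: 'a \<Rightarrow> real)"
    by (auto simp: sublinear_def norm_triangle_ineq)
  from sublinear_linearize_at[OF this] obtain p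
    where p: "sublinear p" "p \<le> norm" "p (- v) \<le> - norm v" by blast
  from sublinear_dominates_linear[OF p(1)] obtain f where f: "linear f" "\<And>x. f x \<le> p x" by blast
  have le: "f x \<le> norm x" for x using f(2)[of x] p(2) by (auto simp: le_fun_def intro: order_trans)
  have neg: "f (- x) = - f x" for x using f(1) by (simp add: linear_neg)
  have "\<bar>f x\<bar> \<le> norm x" for x using le[of x] le[of "- x"] neg[of x] by simp
  moreover have "f v = norm v"
    using le[of v] f(2)[of "- v"] p(3) neg[of v] by simp
  ultimately show ?thesis using f(1) by (auto simp: contraction_functional_def)
qed

section \<open>Uniform boundedness\<close>

text \<open>
  Suppose that the seminorms \<^term>\<open>p t\<close> have unbounded norms \<^term>\<open>N t\<close>. Build partial sums of
  \<open>\<Sum> \<plusminus> 3\<^sup>-\<^sup>j e\<^sub>j\<close>, where \<open>e\<^sub>j\<close> almost attains the norm \<open>N t\<^sub>j \<ge> 6 \<cdot> 4\<^sup>j\<close>. One of the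
  two signs makes the seminorm of the partial sum as large as that of the new term,
  because \<open>p (2 \<xi>) \<le> p (x + \<xi>) + p (x - \<xi>)\<close>, and the later terms are too small to destroy this.
\<close>

lemma uniform_boundedness:
  fixes p :: "'i \<Rightarrow> 'v::real_normed_vector \<Rightarrow> real"
  assumes S: "subspace S" "complete S"
    and add: "\<And>t x y. x \<in> S \<Longrightarrow> y \<in> S \<Longrightarrow> p t (x + y) \<le> p t x + p t y"
    and scale: "\<And>t c x. x \<in> S \<Longrightarrow> p t (c *\<^sub>R x) = \<bar>c\<bar> * p t x"
    and cont: "\<And>t. \<exists>M. \<forall>x\<in>S. p t x \<le> M * norm x"
    and pointwise: "\<And>x. x \<in> S \<Longrightarrow> \<exists>K. \<forall>t. p t x \<le> K"
  shows "\<exists>K. \<forall>t. \<forall>x\<in>S. norm x \<le> 1 \<longrightarrow> p t x \<le> K"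
proof (rule ccontr)
  assume contra: "\<not> ?thesis"
  define N where "N t = (SUP x\<in>{x\<in>S. norm x \<le> 1}. p t x)" for t
  have S0: "0 \<in> S" and Sadd: "\<And>x y. x \<in> S \<Longrightarrow> y \<in> S \<Longrightarrow> x + y \<in> S"
    and Ssc: "\<And>c x. x \<in> S \<Longrightarrow> c *\<^sub>R x \<in> S"
    using S(1) by (auto simp: subspace_def)
  have Sdiff: "x - y \<in> S" if "x \<in> S" "y \<in> S" for x y
    using S(1) that by (simp add: subspace_diff)
  have bdd: "bdd_above (p t ` {x\<in>S. norm x \<le> 1})" for t
  proof -
    obtain M where M: "\<forall>x\<in>S. p t x \<le> M * norm x" using cont by blast
    show ?thesis
    proof (rule bdd_aboveI2[where M = "\<bar>M\<bar>"])
      fix x assume x: "x \<in> {x\<in>S. norm x \<le> 1}"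
      have "p t x \<le> M * norm x" using M x by simp
      also have "\<dots> \<le> \<bar>M\<bar> * 1" using x by (intro mult_mono) auto
      finally show "p t x \<le> \<bar>M\<bar>" by simp
    qed
  qed
  have le_N: "p t x \<le> N t" if "x \<in> S" "norm x \<le> 1" for t x
    unfolding N_def using that by (intro cSUP_upper bdd) auto
  have p0: "p t 0 = 0" for t using scale[OF S0, of t 0] by simp
  have le_N_norm: "p t x \<le> N t * norm x" if x: "x \<in> S" for t x
  proof (cases "x = 0")
    case False
    have "p t (inverse (norm x) *\<^sub>R x) \<le> N t" using x False by (intro le_N Ssc) auto
    then have "inverse (norm x) * p t x \<le> N t"
      using scale[OF x, of t "inverse (norm x)"] by simp
    from mult_left_mono[OF this norm_ge_zero, of x] show ?thesis
      using False by (simp add: mult.commute mult.assoc[symmetric] del: inverse_eq_divide)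
  qed (simp add: p0)
  have "\<exists>t e. e \<in> S \<and> norm e \<le> 1 \<and> N t \<ge> 6 * 4 ^ j \<and> p t e \<ge> 2/3 * N t" for j :: nat
  proof -
    obtain t x where tx: "x \<in> S" "norm x \<le> 1" "p t x > 6 * 4 ^ j"
      using contra by (meson not_le)
    then have N: "N t > 6 * 4 ^ j" using le_N[OF tx(1,2), of t] by simp
    moreover have "(0::real) < 6 * 4 ^ j" by simp
    ultimately have "2/3 * N t < N t" by linarith
    then have "\<exists>e\<in>{x\<in>S. norm x \<le> 1}. 2/3 * N t < p t e"
      using less_cSUP_iff[OF _ bdd, of "2/3 * N t" t] S0 unfolding N_def by fastforce
    then show ?thesis using N by (auto intro: less_imp_le)
  qed
  then obtain t e where e: "\<And>j. e j \<in> S" "\<And>j. norm (e j) \<le> 1"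
    and tN: "\<And>j::nat. N (t j) \<ge> 6 * 4 ^ j" "\<And>j. p (t j) (e j) \<ge> 2/3 * N (t j)"
    by metis
  define \<xi> where "\<xi> j = (1/3::real)^j *\<^sub>R e j" for j
  define step where "step j y = (if p (t j) (y + \<xi> j) \<ge> p (t j) (\<xi> j) then y + \<xi> j else y - \<xi> j)"
    for j y
  define x where "x = rec_nat 0 step"
  have x_Suc: "x (Suc j) = step j (x j)" for j by (simp add: x_def)
  have \<xi>S: "\<xi> j \<in> S" for j by (simp add: \<xi>_def Ssc e)
  have n\<xi>: "norm (\<xi> j) \<le> (1/3)^j" for j using e(2)[of j] by (simp add: \<xi>_def mult_left_le)
  have xS: "x j \<in> S" for j
  proof (induction j)
    case 0 then show ?case using S0 by (simp add: x_def)
  next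
    case (Suc j) then show ?case by (simp add: x_Suc step_def Sadd Sdiff \<xi>S)
  qed
  have big: "p (t j) (x (Suc j)) \<ge> (1/3)^j * (2/3 * N (t j))" for j
  proof -
    have sum: "(x j + \<xi> j) + (\<xi> j - x j) = 2 *\<^sub>R \<xi> j" by (simp add: scaleR_2)
    have "p (t j) (2 *\<^sub>R \<xi> j) \<le> p (t j) (x j + \<xi> j) + p (t j) (\<xi> j - x j)"
      unfolding sum[symmetric] by (rule add) (simp_all add: Sadd Sdiff \<xi>S xS)
    moreover have "p (t j) (\<xi> j - x j) = p (t j) (x j - \<xi> j)"
      using scale[of "x j - \<xi> j" "t j" "- 1"] by (simp add: Sdiff \<xi>S xS)
    moreover have "p (t j) (2 *\<^sub>R \<xi> j) = 2 * p (t j) (\<xi> j)" using scale[OF \<xi>S, of "t j" 2] by simp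
    ultimately have "p (t j) (x (Suc j)) \<ge> p (t j) (\<xi> j)" by (auto simp: x_Suc step_def)
    moreover have "p (t j) (\<xi> j) = (1/3)^j * p (t j) (e j)"
      unfolding \<xi>_def using scale[OF e(1), of "t j" "(1/3)^j"] by simp
    moreover have "(1/3)^j * (2/3 * N (t j)) \<le> (1/3)^j * p (t j) (e j)"
      by (intro mult_left_mono tN) simp
    ultimately show ?thesis by linarith
  qed
  have tail: "norm (x (j + k) - x j) \<le> 3/2 * ((1/3)^j - (1/3)^(j+k))" for j k
  proof (induction k)
    case (Suc k)
    have "norm (x (Suc (j + k)) - x (j + k)) \<le> (1/3)^(j+k)"
      using n\<xi>[of "j + k"] by (simp add: x_Suc step_def)
    then have "norm (x (j + Suc k) - x j) \<le> 3/2 * ((1/3)^j - (1/3)^(j+k)) + (1/3)^(j+k)"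
      using Suc norm_triangle_ineq[of "x (Suc (j + k)) - x (j + k)" "x (j + k) - x j"]
      unfolding add_Suc_right diff_add_cancel add_diff_eq by linarith
    then show ?case by (simp add: field_simps)
  qed simp
  have tail': "norm (x k - x j) \<le> 3/2 * (1/3)^j" if "j \<le> k" for j k
  proof -
    have "norm (x k - x j) \<le> 3/2 * ((1/3)^j - (1/3)^k)" using tail[of j "k - j"] that by simp
    also have "\<dots> \<le> 3/2 * (1/3)^j" by simp
    finally show ?thesis .
  qed
  have "Cauchy x"
  proof (rule CauchyI')
    fix \<epsilon> :: real assume \<epsilon>: "\<epsilon> > 0"
    obtain M where M: "(1/3)^M < \<epsilon> * (2/3)"
      using real_arch_pow_inv[of "\<epsilon> * (2/3)" "1/3"] \<epsilon> by auto
    show "\<exists>M. \<forall>m\<ge>M. \<forall>n>m. dist (x m) (x n) < \<epsilon>"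
    proof (intro exI allI impI)
      fix m n assume mn: "M \<le> m" "m < n"
      have "dist (x m) (x n) \<le> 3/2 * (1/3)^m"
        using tail'[of m n] mn by (simp add: dist_norm norm_minus_commute)
      also have "\<dots> \<le> 3/2 * (1/3)^M" using mn by (simp add: power_decreasing)
      also have "\<dots> < \<epsilon>" using M by simp
      finally show "dist (x m) (x n) < \<epsilon>" .
    qed
  qed
  with xS obtain l where lS: "l \<in> S" and l: "x \<longlonglongrightarrow> l"
    using S(2) unfolding complete_def by blast
  have near: "norm (l - x j) \<le> 3/2 * (1/3)^j" for j
  proof (rule LIMSEQ_le_const2)
    show "(\<lambda>k. norm (x k - x j)) \<longlonglongrightarrow> norm (l - x j)" by (intro tendsto_intros l)
    show "\<exists>M. \<forall>k\<ge>M. norm (x k - x j) \<le> 3/2 * (1/3)^j" using tail' by blast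
  qed
  obtain K where K: "\<And>t. p t l \<le> K" using pointwise[OF lS] by blast
  have "(4/3)^j \<le> K" for j
  proof -
    have "p (t j) (x (Suc j)) \<le> p (t j) l + p (t j) (x (Suc j) - l)"
      using add[of l "x (Suc j) - l" "t j"] by (simp add: lS xS Sdiff)
    also have "p (t j) (x (Suc j) - l) \<le> N (t j) * norm (x (Suc j) - l)"
      by (intro le_N_norm Sdiff lS xS)
    also have "\<dots> \<le> N (t j) * (3/2 * (1/3)^Suc j)"
    proof (rule mult_left_mono)
      show "norm (x (Suc j) - l) \<le> 3/2 * (1/3)^Suc j"
        using near[of "Suc j"] by (simp add: norm_minus_commute)
      have "(0::real) \<le> 6 * 4 ^ j" by simp
      then show "0 \<le> N (t j)" using tN(1)[of j] by linarith
    qed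
    finally have "(1/3)^j * (2/3 * N (t j)) \<le> K + N (t j) * (3/2 * (1/3)^Suc j)"
      using big[of j] K[of "t j"] by linarith
    then have "(1/3)^j * N (t j) \<le> 6 * K" by (simp add: field_simps)
    moreover have "(1/3)^j * (6 * 4^j) \<le> (1/3)^j * N (t j)" by (intro mult_left_mono tN) simp
    moreover have "(1/3::real)^j * (6 * 4^j) = 6 * (4/3)^j" by (simp add: power_divide)
    ultimately show ?thesis by linarith
  qed
  moreover obtain j where "K < (4/3::real)^j" using real_arch_pow[of "4/3" K] by auto
  ultimately show False by (meson not_le)
qed

section \<open>Iterated norms of finitely many sequences\<close>

lemma bounded_range_norm: "bounded (range z) \<Longrightarrow> \<exists>B\<ge>0. \<forall>n. norm (z n) \<le> B"
  by (metis bounded_iff norm_ge_zero order_trans rangeI)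

lemma weakly_nullD:
  fixes f :: "'a::real_normed_vector \<Rightarrow> real"
  shows "weakly_null z \<Longrightarrow> bounded_linear f \<Longrightarrow> (\<lambda>n. f (z n)) \<longlonglongrightarrow> 0"
  by (simp add: weakly_null_def)

text \<open>The points of the sequence are uniformly bounded as functionals on the dual space.\<close>

lemma weakly_null_bounded:
  fixes z :: "nat \<Rightarrow> 'a::real_normed_vector"
  assumes z: "weakly_null z"
  shows "bounded (range z)"
proof -
  let ?p = "\<lambda>n (f::'a \<Rightarrow>\<^sub>L real). \<bar>blinfun_apply f (z n)\<bar>"
  have "\<exists>K. \<forall>n. \<forall>f\<in>UNIV. norm f \<le> 1 \<longrightarrow> ?p n f \<le> K"
  proof (rule uniform_boundedness)
    show "\<exists>M. \<forall>f\<in>UNIV. ?p n f \<le> M * norm f" for n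
      using norm_blinfun[of "_ :: 'a \<Rightarrow>\<^sub>L real" "z n"]
      by (intro exI[of _ "norm (z n)"]) (simp add: mult.commute real_norm_def[symmetric] del: real_norm_def)
    show "\<exists>K. \<forall>n. ?p n f \<le> K" for f
    proof -
      have "(\<lambda>n. blinfun_apply f (z n)) \<longlonglongrightarrow> 0"
        by (rule weakly_nullD[OF z]) (rule blinfun.bounded_linear_right)
      then have "Bseq (\<lambda>n. blinfun_apply f (z n))" by (intro convergent_imp_Bseq convergentI)
      then show ?thesis by (auto simp: Bseq_def)
    qed
  qed (auto simp: blinfun.add_left blinfun.scaleR_left abs_mult complete_UNIV)
  then obtain K where K: "\<And>n f. norm f \<le> 1 \<Longrightarrow> ?p n f \<le> K" by auto
  have "norm (z n) \<le> K" for n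
  proof -
    obtain f where f: "contraction_functional f" "f (z n) = norm (z n)"
      using norming_functional by blast
    have bl: "bounded_linear f" using f(1) by (rule contraction_functional_bounded_linear)
    have "norm (Blinfun f) \<le> 1"
      using f(1) by (intro norm_blinfun_bound)
        (auto simp: bounded_linear_Blinfun_apply[OF bl] contraction_functional_def)
    from K[OF this, of n] show ?thesis by (simp add: bounded_linear_Blinfun_apply[OF bl] f(2))
  qed
  then show ?thesis by (auto intro: boundedI)
qed

lemma weakly_null_scaleR: "weakly_null z \<Longrightarrow> weakly_null (\<lambda>n. c *\<^sub>R z n)"
  unfolding weakly_null_def
  by (auto simp: linear_scale[OF bounded_linear.linear] intro!: tendsto_eq_intros)

lemma weakly_null_add: "weakly_null y \<Longrightarrow> weakly_null z \<Longrightarrow> weakly_null (\<lambda>n. y n + z n)"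
  unfolding weakly_null_def
  by (auto simp: linear_add[OF bounded_linear.linear] intro!: tendsto_eq_intros)

lemma weakly_null_zero: "weakly_null (\<lambda>n. 0)"
  unfolding weakly_null_def by (auto simp: linear_0[OF bounded_linear.linear])

lemma weakly_null_sum:
  "(\<And>i. i \<in> A \<Longrightarrow> weakly_null (z i)) \<Longrightarrow> weakly_null (\<lambda>n. \<Sum>i\<in>A. z i n)"
  by (induction A rule: infinite_finite_induct) (auto intro: weakly_null_zero weakly_null_add)

lemma weakly_null_compose:
  assumes "weakly_null z" and r: "filterlim r sequentially sequentially"
  shows "weakly_null (\<lambda>n. z (r n))"
  unfolding weakly_null_def
  using assms filterlim_compose[OF _ r] weakly_nullD by blast

text \<open>
  The iterated limit of \<open>\<parallel>v + z\<^sub>1(n\<^sub>1) + \<dots> + z\<^sub>k(n\<^sub>k)\<parallel>\<close> along \<^term>\<open>ultra\<close>, with \<open>n\<^sub>1\<close> outermost. The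
  base point \<open>v\<close> carries the terms already chosen, which is what the recursion needs.
\<close>

primrec iter_norm :: "'a::real_normed_vector \<Rightarrow> (nat \<Rightarrow> 'a) list \<Rightarrow> real" where
  "iter_norm v [] = norm v"
| "iter_norm v (z # zs) = Lim ultra (\<lambda>n. iter_norm (v + z n) zs)"

lemma bounded_of_lipschitz:
  assumes z: "bounded (range z)" and lip: "\<And>v w. \<bar>g v - g w\<bar> \<le> norm (v - w)"
  shows "bounded (range (\<lambda>n. g (v + z n) :: real))"
proof -
  obtain B where B: "\<And>n. norm (z n) \<le> B" using bounded_range_norm[OF z] by blast
  have "\<bar>g (v + z n)\<bar> \<le> \<bar>g v\<bar> + B" for n
    using lip[of "v + z n" v] B[of n] by simp
  then show ?thesis by (auto intro!: boundedI)
qed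

lemma iter_norm_lipschitz:
  assumes "\<And>z. z \<in> set zs \<Longrightarrow> bounded (range z)"
  shows "\<bar>iter_norm v zs - iter_norm w zs\<bar> \<le> norm (v - w)"
  using assms
proof (induction zs arbitrary: v w)
  case Nil
  then show ?case by (simp add: norm_triangle_ineq3)
next
  case (Cons z zs)
  then have IH: "\<And>v w. \<bar>iter_norm v zs - iter_norm w zs\<bar> \<le> norm (v - w)" by simp
  have lim: "((\<lambda>n. iter_norm (v + z n) zs) \<longlongrightarrow> iter_norm v (z # zs)) ultra" for v
    unfolding iter_norm.simps
    by (intro ultra_lim bounded_of_lipschitz[where g = "\<lambda>v. iter_norm v zs"] IH) (use Cons.prems in auto)
  show ?case
  proof (rule ultra_limit_le)
    show "((\<lambda>n. \<bar>iter_norm (v + z n) zs - iter_norm (w + z n) zs\<bar>) \<longlongrightarrow>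
        \<bar>iter_norm v (z # zs) - iter_norm w (z # zs)\<bar>) ultra"
      by (intro tendsto_intros lim)
    show "((\<lambda>n. norm (v - w)) \<longlongrightarrow> norm (v - w)) ultra" by simp
    show "\<bar>iter_norm (v + z n) zs - iter_norm (w + z n) zs\<bar> \<le> norm (v - w)" for n
      using IH[of "v + z n" "w + z n"] by simp
  qed
qed

lemma iter_norm_lim:
  assumes "\<And>y. y \<in> set (z # zs) \<Longrightarrow> bounded (range y)"
  shows "((\<lambda>n. iter_norm (v + z n) zs) \<longlongrightarrow> iter_norm v (z # zs)) ultra"
  unfolding iter_norm.simps
  by (intro ultra_lim bounded_of_lipschitz[where g = "\<lambda>v. iter_norm v zs"] iter_norm_lipschitz)
    (use assms in auto)

lemma bounded_range_add:
  fixes f g :: "'i \<Rightarrow> 'a::real_normed_vector"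
  shows "bounded (range f) \<Longrightarrow> bounded (range g) \<Longrightarrow> bounded (range (\<lambda>n. f n + g n))"
  by (rule bounded_plus_comp)

lemma bounded_range_scaleR:
  fixes f :: "'i \<Rightarrow> 'a::real_normed_vector"
  shows "bounded (range f) \<Longrightarrow> bounded (range (\<lambda>n. c *\<^sub>R f n))"
  by (rule bounded_scaleR_comp)

lemma bounded_range_sum:
  fixes f :: "'d \<Rightarrow> 'i \<Rightarrow> 'a::real_normed_vector"
  shows "(\<And>d. d \<in> D \<Longrightarrow> bounded (range (f d))) \<Longrightarrow> bounded (range (\<lambda>n. \<Sum>d\<in>D. f d n))"
  by (induction D rule: infinite_finite_induct) (auto intro: bounded_range_add)

lemma iter_norm_add:
  assumes "\<And>i. i \<in> set is \<Longrightarrow> bounded (range (f i))" "\<And>i. i \<in> set is \<Longrightarrow> bounded (range (g i))"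
  shows "iter_norm (v + w) (map (\<lambda>i n. f i n + g i n) is)
    \<le> iter_norm v (map f is) + iter_norm w (map g is)"
  using assms
proof (induction "is" arbitrary: v w)
  case Nil
  then show ?case by (simp add: norm_triangle_ineq)
next
  case (Cons i "is")
  show ?case
  proof (rule ultra_limit_le)
    show "((\<lambda>n. iter_norm (v + w + (f i n + g i n)) (map (\<lambda>i n. f i n + g i n) is)) \<longlongrightarrow>
      iter_norm (v + w) (map (\<lambda>i n. f i n + g i n) (i # is))) ultra"
      using iter_norm_lim[of "\<lambda>n. f i n + g i n" "map (\<lambda>i n. f i n + g i n) is" "v + w"] Cons.prems
      by (auto intro: bounded_range_add)
    show "((\<lambda>n. iter_norm (v + f i n) (map f is) + iter_norm (w + g i n) (map g is)) \<longlongrightarrow>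
      iter_norm v (map f (i # is)) + iter_norm w (map g (i # is))) ultra"
      unfolding list.map by (intro tendsto_add iter_norm_lim) (use Cons.prems in auto)
    show "iter_norm (v + w + (f i n + g i n)) (map (\<lambda>i n. f i n + g i n) is)
      \<le> iter_norm (v + f i n) (map f is) + iter_norm (w + g i n) (map g is)" for n
      using Cons.IH[of "v + f i n" "w + g i n"] Cons.prems by (simp add: add_ac)
  qed
qed

lemma iter_norm_scaleR:
  assumes "\<And>i. i \<in> set is \<Longrightarrow> bounded (range (f i))"
  shows "iter_norm (c *\<^sub>R v) (map (\<lambda>i n. c *\<^sub>R f i n) is) = \<bar>c\<bar> * iter_norm v (map f is)"
  using assms
proof (induction "is" arbitrary: v)
  case (Cons i "is")
  have "((\<lambda>n. \<bar>c\<bar> * iter_norm (v + f i n) (map f is)) \<longlongrightarrow>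
      \<bar>c\<bar> * iter_norm v (map f (i # is))) ultra"
    unfolding list.map by (intro tendsto_intros iter_norm_lim) (use Cons.prems in auto)
  then have "((\<lambda>n. iter_norm (c *\<^sub>R v + c *\<^sub>R f i n) (map (\<lambda>i n. c *\<^sub>R f i n) is)) \<longlongrightarrow>
      \<bar>c\<bar> * iter_norm v (map f (i # is))) ultra"
    using Cons by (simp add: scaleR_add_right[symmetric])
  then show ?case using ultra_Lim_eq by simp
qed simp

lemma iter_norm_sum:
  fixes f :: "'d \<Rightarrow> 'i \<Rightarrow> nat \<Rightarrow> 'a::real_normed_vector"
  assumes "finite D" "\<And>A i. A \<in> D \<Longrightarrow> i \<in> set is \<Longrightarrow> bounded (range (f A i))"
  shows "iter_norm 0 (map (\<lambda>i n. \<Sum>A\<in>D. f A i n) is) \<le> (\<Sum>A\<in>D. iter_norm 0 (map (f A) is))"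
  using assms
proof (induction D rule: finite_induct)
  case empty
  have "iter_norm 0 (map (\<lambda>i n. (0::'a)) is) = 0"
    by (induction "is") (auto intro: ultra_Lim_eq)
  then show ?case by simp
next
  case (insert A D)
  have bd: "bounded (range (\<lambda>n. \<Sum>A\<in>D. f A i n))" if "i \<in> set is" for i
    using insert.prems that by (intro bounded_range_sum) auto
  have "iter_norm (0 + 0) (map (\<lambda>i n. f A i n + (\<Sum>A\<in>D. f A i n)) is)
      \<le> iter_norm 0 (map (f A) is) + iter_norm 0 (map (\<lambda>i n. \<Sum>A\<in>D. f A i n) is)"
    by (rule iter_norm_add) (use insert.prems bd in auto)
  then show ?case using insert by simp
qed

text \<open>
  Bounds along \<^term>\<open>ultra\<close> suffice, so that a sequence may be replaced by one that is merely
  asymptotically close to it.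
\<close>

lemma iter_norm_le_sum_list:
  assumes "\<And>i. i \<in> set is \<Longrightarrow> bounded (range (f i))"
    and "\<And>i. i \<in> set is \<Longrightarrow> eventually (\<lambda>n. norm (f i n) \<le> e i) ultra"
  shows "iter_norm v (map f is) \<le> norm v + (\<Sum>i\<leftarrow>is. e i)"
  using assms
proof (induction "is" arbitrary: v)
  case (Cons i "is")
  have "eventually (\<lambda>n. iter_norm (v + f i n) (map f is) \<le> norm v + (\<Sum>i\<leftarrow>i # is. e i)) ultra"
  proof (rule eventually_mono)
    show "eventually (\<lambda>n. norm (f i n) \<le> e i) ultra" using Cons.prems by simp
    fix n assume "norm (f i n) \<le> e i"
    moreover have "iter_norm (v + f i n) (map f is) \<le> norm (v + f i n) + (\<Sum>i\<leftarrow>is. e i)"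
      using Cons by simp
    ultimately show "iter_norm (v + f i n) (map f is) \<le> norm v + (\<Sum>i\<leftarrow>i # is. e i)"
      using norm_triangle_ineq[of v "f i n"] by simp
  qed
  moreover have "((\<lambda>n. iter_norm (v + f i n) (map f is)) \<longlongrightarrow> iter_norm v (map f (i # is))) ultra"
    unfolding list.map by (intro iter_norm_lim) (use Cons.prems in auto)
  ultimately show ?case by (intro tendsto_upperbound) auto
qed simp

lemma iter_norm_perturb:
  assumes "\<And>i. i \<in> set is \<Longrightarrow> bounded (range (f i))" "\<And>i. i \<in> set is \<Longrightarrow> bounded (range (g i))"
    and "\<And>i. i \<in> set is \<Longrightarrow> eventually (\<lambda>n. norm (f i n - g i n) \<le> e i) ultra"
  shows "iter_norm v (map f is) \<le> iter_norm w (map g is) + (norm (v - w) + (\<Sum>i\<leftarrow>is. e i))"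
proof -
  have bd: "bounded (range (\<lambda>n. f i n - g i n))" if "i \<in> set is" for i
    using assms(1,2)[OF that] by (rule bounded_minus_comp)
  have "iter_norm (w + (v - w)) (map (\<lambda>i n. g i n + (f i n - g i n)) is)
      \<le> iter_norm w (map g is) + iter_norm (v - w) (map (\<lambda>i n. f i n - g i n) is)"
    by (rule iter_norm_add) (use assms bd in auto)
  also have "iter_norm (v - w) (map (\<lambda>i n. f i n - g i n) is) \<le> norm (v - w) + (\<Sum>i\<leftarrow>is. e i)"
    by (rule iter_norm_le_sum_list) (use assms bd in auto)
  finally show ?thesis by simp
qed

text \<open>
  A subgradient of the convex function \<^term>\<open>\<lambda>v. iter_norm v ws\<close> is obtained as the iterated limit
  of functionals that norm the sums \<open>v + w\<^sub>1(n\<^sub>1) + \<dots> + w\<^sub>k(n\<^sub>k)\<close>.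
\<close>

lemma iter_norm_subgradient:
  assumes "\<And>z. z \<in> set ws \<Longrightarrow> bounded (range z)"
  shows "\<exists>f. contraction_functional f \<and> (\<forall>h. iter_norm v ws + f h \<le> iter_norm (v + h) ws)"
  using assms
proof (induction ws arbitrary: v)
  case Nil
  obtain f where f: "contraction_functional f" "f v = norm v" using norming_functional by blast
  have "norm v + f h \<le> norm (v + h)" for h
  proof -
    have "norm v + f h = f (v + h)"
      using f by (simp add: contraction_functional_def linear_add)
    also have "\<dots> \<le> norm (v + h)" using f(1) by (auto simp: contraction_functional_def dest: abs_le_D1)
    finally show ?thesis .
  qed
  then show ?case using f by auto
next
  case (Cons w ws)
  have "\<exists>f. contraction_functional f \<and> (\<forall>h. iter_norm u ws + f h \<le> iter_norm (u + h) ws)" for u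
    using Cons by simp
  then obtain F where F: "\<And>u. contraction_functional (F u)"
    "\<And>u h. iter_norm u ws + F u h \<le> iter_norm (u + h) ws" by metis
  define f where "f h = Lim ultra (\<lambda>n. F (v + w n) h)" for h
  have bound: "\<bar>F u h\<bar> \<le> norm h" for u h using F(1) by (simp add: contraction_functional_def)
  have lin: "linear (F u)" for u using F(1) by (simp add: contraction_functional_def)
  have lim: "((\<lambda>n. F (v + w n) h) \<longlongrightarrow> f h) ultra" for h
    unfolding f_def by (rule ultra_lim, rule boundedI[where B = "norm h"]) (use bound in auto)
  have f_eq: "f h = l" if "((\<lambda>n. F (v + w n) h) \<longlongrightarrow> l) ultra" for h l
    unfolding f_def using that by (rule ultra_Lim_eq)
  have "linear f"
  proof (rule linearI)
    fix x y :: 'a and c :: real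
    have "((\<lambda>n. F (v + w n) x + F (v + w n) y) \<longlongrightarrow> f x + f y) ultra" by (intro tendsto_add lim)
    then have "((\<lambda>n. F (v + w n) (x + y)) \<longlongrightarrow> f x + f y) ultra" by (simp add: linear_add[OF lin])
    then show "f (x + y) = f x + f y" by (rule f_eq)
    have "((\<lambda>n. c * F (v + w n) x) \<longlongrightarrow> c * f x) ultra" by (intro tendsto_intros lim)
    then have "((\<lambda>n. F (v + w n) (c *\<^sub>R x)) \<longlongrightarrow> c * f x) ultra" by (simp add: linear_scale[OF lin])
    then show "f (c *\<^sub>R x) = c *\<^sub>R f x" unfolding real_scaleR_def by (rule f_eq)
  qed
  moreover have "\<bar>f x\<bar> \<le> norm x" for x
    by (rule ultra_limit_le[OF tendsto_rabs[OF lim] tendsto_const bound])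
  moreover have "iter_norm v (w # ws) + f h \<le> iter_norm (v + h) (w # ws)" for h
  proof (rule ultra_limit_le)
    show "((\<lambda>n. iter_norm (v + w n) ws + F (v + w n) h) \<longlongrightarrow> iter_norm v (w # ws) + f h) ultra"
      by (intro tendsto_add lim iter_norm_lim) (use Cons.prems in auto)
    show "((\<lambda>n. iter_norm (v + h + w n) ws) \<longlongrightarrow> iter_norm (v + h) (w # ws)) ultra"
      by (intro iter_norm_lim) (use Cons.prems in auto)
    show "iter_norm (v + w n) ws + F (v + w n) h \<le> iter_norm (v + h + w n) ws" for n
      using F(2)[of "v + w n" h] by (simp add: add_ac)
  qed
  ultimately show ?case by (auto simp: contraction_functional_def)
qed

text \<open>Convexity makes \<^term>\<open>\<lambda>v. iter_norm v ws\<close> weakly lower semicontinuous.\<close>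

lemma iter_norm_Cons_ge:
  assumes z: "weakly_null z" and ws: "\<And>w. w \<in> set ws \<Longrightarrow> bounded (range w)"
  shows "iter_norm v ws \<le> iter_norm v (z # ws)"
proof -
  obtain f where f: "contraction_functional f"
    "\<And>h. iter_norm v ws + f h \<le> iter_norm (v + h) ws"
    using iter_norm_subgradient[OF ws, of ws v] by blast
  have "(\<lambda>n. f (z n)) \<longlonglongrightarrow> 0"
    by (intro weakly_nullD[OF z] contraction_functional_bounded_linear f)
  then have "((\<lambda>n. iter_norm v ws + f (z n)) \<longlongrightarrow> iter_norm v ws + 0) ultra"
    by (intro tendsto_intros tendsto_ultra)
  moreover have "((\<lambda>n. iter_norm (v + z n) ws) \<longlongrightarrow> iter_norm v (z # ws)) ultra"
    by (intro iter_norm_lim) (use ws weakly_null_bounded[OF z] in auto)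
  ultimately have "iter_norm v ws + 0 \<le> iter_norm v (z # ws)" by (rule ultra_limit_le) (rule f)
  then show ?thesis by simp
qed

lemma iter_norm_append_ge:
  assumes "\<And>z. z \<in> set zs \<Longrightarrow> bounded (range z)" "\<And>z. z \<in> set ws \<Longrightarrow> weakly_null z"
  shows "iter_norm v zs \<le> iter_norm v (zs @ ws)"
  using assms
proof (induction zs arbitrary: v)
  case Nil
  then show ?case
  proof (induction ws)
    case (Cons w ws)
    have "norm v \<le> iter_norm v ws" using Cons by simp
    also have "\<dots> \<le> iter_norm v (w # ws)"
      by (intro iter_norm_Cons_ge) (use Cons.prems weakly_null_bounded in auto)
    finally show ?case by simp
  qed simp
next
  case (Cons z zs)
  show ?case
    unfolding append_Cons
  proof (rule ultra_limit_le)
    show "((\<lambda>n. iter_norm (v + z n) zs) \<longlongrightarrow> iter_norm v (z # zs)) ultra"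
      by (intro iter_norm_lim) (use Cons.prems in auto)
    show "((\<lambda>n. iter_norm (v + z n) (zs @ ws)) \<longlongrightarrow> iter_norm v (z # zs @ ws)) ultra"
      by (intro iter_norm_lim) (use Cons.prems weakly_null_bounded in auto)
  qed (use Cons in auto)
qed

text \<open>
  Omitting an entry does not increase the iterated norm, by lower semicontinuity. So arrays
  of weakly null sequences are suppression unconditional in the limit, whether or not the sequences
  themselves have unconditional subsequences.
\<close>

lemma iter_norm_suppress:
  assumes "\<And>i. i \<in> set is \<Longrightarrow> weakly_null (f i)"
  shows "iter_norm v (map (\<lambda>i n. if i \<in> A then f i n else 0) is) \<le> iter_norm v (map f is)"
  using assms
proof (induction "is" arbitrary: v)
  case (Cons i "is")
  let ?g = "\<lambda>i n. if i \<in> A then f i n else 0"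
  have wn: "weakly_null (?g i)" if "i \<in> set is" for i
    using Cons.prems that weakly_null_zero by (cases "i \<in> A") auto
  have IH: "iter_norm u (map ?g is) \<le> iter_norm u (map f is)" for u using Cons by simp
  have lim: "((\<lambda>n. iter_norm (v + f i n) (map f is)) \<longlongrightarrow> iter_norm v (map f (i # is))) ultra"
    unfolding list.map by (intro iter_norm_lim) (use Cons.prems weakly_null_bounded in auto)
  show ?case
  proof (cases "i \<in> A")
    case True
    show ?thesis
    proof (rule ultra_limit_le[OF _ lim IH])
      have "((\<lambda>n. iter_norm (v + f i n) (map ?g is)) \<longlongrightarrow> iter_norm v (f i # map ?g is)) ultra"
      proof (rule iter_norm_lim)
        fix y assume "y \<in> set (f i # map ?g is)"
        then have "weakly_null y" using Cons.prems wn by auto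
        then show "bounded (range y)" by (rule weakly_null_bounded)
      qed
      then show "((\<lambda>n. iter_norm (v + f i n) (map ?g is)) \<longlongrightarrow> iter_norm v (map ?g (i # is))) ultra"
        using True by simp
    qed
  next
    case False
    then have "iter_norm v (map ?g (i # is)) = iter_norm v (map ?g is)"
      by (simp add: ultra_Lim_eq)
    also have "\<dots> \<le> iter_norm v (map f is)" by (rule IH)
    also have "\<dots> \<le> iter_norm v (f i # map f is)"
      by (rule iter_norm_Cons_ge) (use Cons.prems weakly_null_bounded in auto)
    finally show ?thesis by simp
  qed
qed simp

section \<open>Basic subsequences and spreading models\<close>

text \<open>
  Equicontinuity turns pointwise convergence into uniform convergence on the cube, through
  a finite grid.
\<close>

lemma ultra_uniform_on_cube:
  fixes f :: "nat \<Rightarrow> ('i \<Rightarrow> real) \<Rightarrow> real"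
  assumes fin: "finite I"
    and lip: "\<And>n d d'. \<bar>f n d - f n d'\<bar> \<le> (\<Sum>i\<in>I. \<bar>d i - d' i\<bar>)"
    and lim: "\<And>d. ((\<lambda>n. f n d) \<longlongrightarrow> g d) ultra" and \<epsilon>: "\<epsilon> > 0"
  shows "\<forall>\<^sub>F n in ultra. \<forall>d. (\<forall>i\<in>I. \<bar>d i\<bar> \<le> 1) \<longrightarrow> \<bar>f n d - g d\<bar> \<le> \<epsilon>"
proof -
  have lipg: "\<bar>g d - g d'\<bar> \<le> (\<Sum>i\<in>I. \<bar>d i - d' i\<bar>)" for d d'
  proof (rule ultra_limit_le[OF _ tendsto_const lip])
    show "((\<lambda>n. \<bar>f n d - f n d'\<bar>) \<longlongrightarrow> \<bar>g d - g d'\<bar>) ultra" by (intro tendsto_intros lim)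
  qed
  obtain q :: nat where q: "q > 0" "card I / q < \<epsilon> / 3"
  proof -
    obtain q :: nat where "3 * card I / \<epsilon> < q" using reals_Archimedean2 by blast
    then have "3 * card I / \<epsilon> < Suc q" by simp
    then have "real (card I) / Suc q < \<epsilon> / 3" using \<epsilon> by (simp add: field_simps)
    then show ?thesis using that[of "Suc q"] by blast
  qed
  define D where "D = PiE I (\<lambda>_. (\<lambda>k. real_of_int k / q) ` {- int q..int q})"
  have "finite D" unfolding D_def by (intro finite_PiE fin) auto
  moreover have "eventually (\<lambda>n. \<bar>f n d - g d\<bar> < \<epsilon> / 3) ultra" for d
    using tendstoD[OF lim[of d], of "\<epsilon> / 3"] \<epsilon> by (simp add: dist_real_def)
  ultimately have "eventually (\<lambda>n. \<forall>d\<in>D. \<bar>f n d - g d\<bar> < \<epsilon> / 3) ultra"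
    by (intro eventually_ball_finite) auto
  then show ?thesis
  proof eventually_elim
    case (elim n)
    show ?case
    proof (intro allI impI)
      fix d :: "'i \<Rightarrow> real" assume d: "\<forall>i\<in>I. \<bar>d i\<bar> \<le> 1"
      define d' where "d' = restrict (\<lambda>i. real_of_int \<lfloor>d i * q\<rfloor> / q) I"
      have "\<lfloor>d i * q\<rfloor> \<in> {- int q..int q}" if "i \<in> I" for i
      proof -
        have "- 1 \<le> d i" "d i \<le> 1" using d that by (auto simp: abs_le_iff)
        then have "- 1 * real q \<le> d i * q" "d i * q \<le> 1 * real q"
          by (intro mult_right_mono; simp)+
        then show ?thesis by (auto simp: le_floor_iff floor_le_iff)
      qed
      then have d': "d' \<in> D" by (auto simp: d'_def D_def)
      have near: "\<bar>d i - d' i\<bar> \<le> 1 / q" if "i \<in> I" for i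
      proof -
        have eq: "d i - d' i = (d i * q - \<lfloor>d i * q\<rfloor>) / q" using q that by (simp add: d'_def field_simps)
        have "0 \<le> (d i * q - \<lfloor>d i * q\<rfloor>) / q" by simp
        then have "\<bar>d i - d' i\<bar> = (d i * q - \<lfloor>d i * q\<rfloor>) / q" unfolding eq by (rule abs_of_nonneg)
        also have "\<dots> \<le> 1 / q" by (intro divide_right_mono) linarith+
        finally show ?thesis .
      qed
      have "(\<Sum>i\<in>I. \<bar>d i - d' i\<bar>) \<le> card I * (1 / q)" by (rule sum_bounded_above) (rule near)
      also have "\<dots> = card I / q" by simp
      finally have sum: "(\<Sum>i\<in>I. \<bar>d i - d' i\<bar>) < \<epsilon> / 3" using q(2) by (rule order_le_less_trans)
      have "\<bar>f n d' - g d'\<bar> < \<epsilon> / 3" using elim d' by blast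
      then show "\<bar>f n d - g d\<bar> \<le> \<epsilon>"
        using lip[of n d d'] lipg[of d d'] sum by linarith
    qed
  qed
qed

lemma map_nth_comp: "map (\<lambda>i. F (xs ! i)) [0..<length xs] = map F xs"
  by (rule nth_equalityI) simp_all

text \<open>
  Iterated norms are Lipschitz in the coefficients, so the convergence that defines the outermost
  limit is uniform over coefficients in the cube.
\<close>

lemma eventually_iter_norm_uniform:
  fixes w u :: "nat \<Rightarrow> 'a::real_normed_vector"
  assumes w: "\<And>n. norm (w n) \<le> 1" and u: "\<And>i. norm (u i) \<le> 1" and \<epsilon>: "\<epsilon> > 0"
  shows "\<forall>\<^sub>F n in ultra. \<forall>c b bs. (\<forall>i<j. \<bar>c i\<bar> \<le> 1) \<longrightarrow> (\<forall>a\<in>set (b # bs). \<bar>a\<bar> \<le> 1) \<longrightarrow> length bs = k \<longrightarrow>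
    \<bar>iter_norm ((\<Sum>i<j. c i *\<^sub>R u i) + b *\<^sub>R w n) (map (\<lambda>a n. a *\<^sub>R w n) bs)
      - iter_norm (\<Sum>i<j. c i *\<^sub>R u i) (map (\<lambda>a n. a *\<^sub>R w n) (b # bs))\<bar> \<le> \<epsilon>"
proof -
  define I where "I = {..<j} <+> {..<Suc k}"
  define V where "V d = (\<Sum>i<j. d (Inl i) *\<^sub>R u i)" for d :: "nat + nat \<Rightarrow> real"
  define W where "W d = map (\<lambda>i n. d (Inr (Suc i)) *\<^sub>R w n) [0..<k]" for d :: "nat + nat \<Rightarrow> real"
  define f where "f n d = iter_norm (V d + d (Inr 0) *\<^sub>R w n) (W d)" for n d
  define g where "g d = iter_norm (V d) ((\<lambda>n. d (Inr 0) *\<^sub>R w n) # W d)" for d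
  have bw: "bounded (range (\<lambda>n. c *\<^sub>R w n))" for c
    by (rule bounded_range_scaleR) (use w in \<open>auto intro: boundedI\<close>)
  have le: "f n d \<le> f n d' + (\<Sum>i\<in>I. \<bar>d i - d' i\<bar>)" for n d d'
  proof -
    have "f n d \<le> f n d' + (norm ((V d + d (Inr 0) *\<^sub>R w n) - (V d' + d' (Inr 0) *\<^sub>R w n))
        + (\<Sum>i\<leftarrow>[0..<k]. \<bar>d (Inr (Suc i)) - d' (Inr (Suc i))\<bar>))"
      unfolding f_def W_def
    proof (rule iter_norm_perturb)
      show "\<forall>\<^sub>F n in ultra. norm (d (Inr (Suc i)) *\<^sub>R w n - d' (Inr (Suc i)) *\<^sub>R w n)
          \<le> \<bar>d (Inr (Suc i)) - d' (Inr (Suc i))\<bar>" for i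
        using w by (intro always_eventually allI) (simp add: scaleR_diff_left[symmetric] mult_left_le)
    qed (rule bw)+
    also have "norm ((V d + d (Inr 0) *\<^sub>R w n) - (V d' + d' (Inr 0) *\<^sub>R w n))
        \<le> norm (V d - V d') + norm (d (Inr 0) *\<^sub>R w n - d' (Inr 0) *\<^sub>R w n)"
      by (rule norm_diff_triangle_ineq)
    also have "norm (V d - V d') \<le> (\<Sum>i<j. \<bar>d (Inl i) - d' (Inl i)\<bar>)"
      unfolding V_def sum_subtractf[symmetric] scaleR_diff_left[symmetric]
      by (rule sum_norm_le) (use u in \<open>simp add: mult_left_le\<close>)
    also have "norm (d (Inr 0) *\<^sub>R w n - d' (Inr 0) *\<^sub>R w n) \<le> \<bar>d (Inr 0) - d' (Inr 0)\<bar>"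
      using w by (simp add: scaleR_diff_left[symmetric] mult_left_le)
    also have "(\<Sum>i\<leftarrow>[0..<k]. \<bar>d (Inr (Suc i)) - d' (Inr (Suc i))\<bar>)
        = (\<Sum>i<k. \<bar>d (Inr (Suc i)) - d' (Inr (Suc i))\<bar>)"
      by (simp add: sum_set_upt_conv_sum_list_nat[symmetric] lessThan_atLeast0)
    finally show ?thesis
      unfolding I_def by (simp add: sum.Plus sum.lessThan_Suc_shift del: sum.lessThan_Suc)
  qed
  have "\<forall>\<^sub>F n in ultra. \<forall>d. (\<forall>i\<in>I. \<bar>d i\<bar> \<le> 1) \<longrightarrow> \<bar>f n d - g d\<bar> \<le> \<epsilon>"
  proof (rule ultra_uniform_on_cube[OF _ _ _ \<epsilon>])
    show "finite I" by (simp add: I_def)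
    show "\<bar>f n d - f n d'\<bar> \<le> (\<Sum>i\<in>I. \<bar>d i - d' i\<bar>)" for n d d'
      using le[of n d d'] le[of n d' d] by (simp add: abs_le_iff abs_minus_commute)
    show "((\<lambda>n. f n d) \<longlongrightarrow> g d) ultra" for d
      unfolding f_def g_def by (rule iter_norm_lim) (use bw in \<open>auto simp: W_def\<close>)
  qed
  then show ?thesis
  proof eventually_elim
    case (elim n)
    show ?case
    proof (intro allI impI)
      fix c :: "nat \<Rightarrow> real" and b bs
      assume c: "\<forall>i<j. \<bar>c i\<bar> \<le> 1" and b: "\<forall>a\<in>set (b # bs). \<bar>a\<bar> \<le> (1::real)" and k: "length bs = k"
      define d where "d = case_sum c (\<lambda>i. (b # bs) ! i)"
      have "\<bar>(b # bs) ! i\<bar> \<le> 1" if "i < Suc k" for i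
        using b k that nth_mem[of i "b # bs"] by (metis length_Cons)
      then have "\<forall>i\<in>I. \<bar>d i\<bar> \<le> 1" using c by (auto simp: d_def I_def)
      then have "\<bar>f n d - g d\<bar> \<le> \<epsilon>" using elim by blast
      moreover have "W d = map (\<lambda>a n. a *\<^sub>R w n) bs"
        unfolding W_def d_def using map_nth_comp[of "\<lambda>a n. a *\<^sub>R w n" bs] k by simp
      ultimately show "\<bar>iter_norm ((\<Sum>i<j. c i *\<^sub>R u i) + b *\<^sub>R w n) (map (\<lambda>a n. a *\<^sub>R w n) bs)
          - iter_norm (\<Sum>i<j. c i *\<^sub>R u i) (map (\<lambda>a n. a *\<^sub>R w n) (b # bs))\<bar> \<le> \<epsilon>"
        by (simp add: f_def g_def V_def d_def)
    qed
  qed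
qed

text \<open>
  For coefficients in the unit interval, replacing the outermost limit variable by the actual term
  \<^term>\<open>w (r j)\<close> changes the iterated norm by at most \<^term>\<open>\<epsilon> j\<close>. The number
  of remaining variables is limited by \<open>j\<close>, so that the choice of each term is subject to finitely
  many conditions that hold uniformly in the coefficients.
\<close>

definition approximates_limits :: "(nat \<Rightarrow> 'a::real_normed_vector) \<Rightarrow> (nat \<Rightarrow> nat) \<Rightarrow> (nat \<Rightarrow> real) \<Rightarrow> bool" where
  "approximates_limits w r \<epsilon> \<longleftrightarrow>
    (\<forall>j c b bs. (\<forall>i<j. \<bar>c i\<bar> \<le> 1) \<longrightarrow> (\<forall>a\<in>set (b # bs). \<bar>a\<bar> \<le> 1) \<longrightarrow> length bs \<le> j \<longrightarrow>
      \<bar>iter_norm ((\<Sum>i<j. c i *\<^sub>R w (r i)) + b *\<^sub>R w (r j)) (map (\<lambda>a n. a *\<^sub>R w n) bs)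
        - iter_norm (\<Sum>i<j. c i *\<^sub>R w (r i)) (map (\<lambda>a n. a *\<^sub>R w n) (b # bs))\<bar> \<le> \<epsilon> j)"

lemma approximates_limitsD:
  assumes "approximates_limits w r \<epsilon>" "\<forall>i<j. \<bar>c i\<bar> \<le> 1" "\<forall>a\<in>set (b # bs). \<bar>a\<bar> \<le> 1" "length bs \<le> j"
  shows "\<bar>iter_norm ((\<Sum>i<j. c i *\<^sub>R w (r i)) + b *\<^sub>R w (r j)) (map (\<lambda>a n. a *\<^sub>R w n) bs)
    - iter_norm (\<Sum>i<j. c i *\<^sub>R w (r i)) (map (\<lambda>a n. a *\<^sub>R w n) (b # bs))\<bar> \<le> \<epsilon> j"
  using assms unfolding approximates_limits_def by blast

lemma exists_approximating_subsequence:
  fixes w :: "nat \<Rightarrow> 'a::real_normed_vector"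
  assumes w: "\<And>n. norm (w n) \<le> 1" and w1: "\<forall>\<^sub>F n in ultra. norm (w n) = 1"
    and \<epsilon>: "\<And>j. \<epsilon> j > 0"
  shows "\<exists>r. strict_mono r \<and> (\<forall>j. norm (w (r j)) = 1) \<and> approximates_limits w r \<epsilon>"
proof -
  define P where "P r j n \<longleftrightarrow> (\<forall>i<j. r i < n) \<and> norm (w n) = 1 \<and>
    (\<forall>c b bs. (\<forall>i<j. \<bar>c i\<bar> \<le> 1) \<longrightarrow> (\<forall>a\<in>set (b # bs). \<bar>a\<bar> \<le> 1) \<longrightarrow> length bs \<le> j \<longrightarrow>
      \<bar>iter_norm ((\<Sum>i<j. c i *\<^sub>R w (r i)) + b *\<^sub>R w n) (map (\<lambda>a n. a *\<^sub>R w n) bs)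
        - iter_norm (\<Sum>i<j. c i *\<^sub>R w (r i)) (map (\<lambda>a n. a *\<^sub>R w n) (b # bs))\<bar> \<le> \<epsilon> j)" for r j n
  have "\<exists>r. \<forall>j. P r j (r j)"
  proof (rule dependent_wellorder_choice)
    fix n :: nat and r r' :: "nat \<Rightarrow> nat" and j
    assume eq: "\<And>i. i < j \<Longrightarrow> r i = r' i"
    then have "(\<Sum>i<j. c i *\<^sub>R w (r i)) = (\<Sum>i<j. c i *\<^sub>R w (r' i))" for c by simp
    then show "P r j n = P r' j n" unfolding P_def using eq by simp
  next
    fix j and r :: "nat \<Rightarrow> nat"
    have "\<forall>\<^sub>F n in ultra. \<forall>i\<in>{..<j}. r i < n"
      by (intro eventually_ball_finite ballI eventually_ultra eventually_gt_at_top) auto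
    moreover have "\<forall>\<^sub>F n in ultra. \<forall>k\<in>{..j}. \<forall>c b bs.
        (\<forall>i<j. \<bar>c i\<bar> \<le> 1) \<longrightarrow> (\<forall>a\<in>set (b # bs). \<bar>a\<bar> \<le> 1) \<longrightarrow> length bs = k \<longrightarrow>
      \<bar>iter_norm ((\<Sum>i<j. c i *\<^sub>R w (r i)) + b *\<^sub>R w n) (map (\<lambda>a n. a *\<^sub>R w n) bs)
        - iter_norm (\<Sum>i<j. c i *\<^sub>R w (r i)) (map (\<lambda>a n. a *\<^sub>R w n) (b # bs))\<bar> \<le> \<epsilon> j"
      by (intro eventually_ball_finite ballI eventually_iter_norm_uniform w \<epsilon>) auto
    ultimately have "\<forall>\<^sub>F n in ultra. P r j n"
      using w1 unfolding P_def by eventually_elim (simp only: atMost_iff lessThan_iff Ball_def, blast)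
    then show "\<exists>n. P r j n" by (rule ultra_ex)
  qed
  then obtain r where r: "\<And>j. P r j (r j)" by blast
  then have "strict_mono r" unfolding P_def by (auto simp: strict_mono_Suc_iff)
  then show ?thesis using r unfolding P_def approximates_limits_def by blast
qed

text \<open>Replace the limit variables by actual terms one after the other, from the outside inwards.\<close>

lemma approximates_limits_spread:
  fixes w :: "nat \<Rightarrow> 'a::real_normed_vector"
  assumes r: "approximates_limits w r \<epsilon>" and \<epsilon>: "antimono \<epsilon>"
    and n: "strict_mono_on {..<k} n" "\<And>i. i < k \<Longrightarrow> N \<le> n i" and N: "k \<le> N"
    and a: "\<And>i. i < k \<Longrightarrow> \<bar>a i\<bar> \<le> 1"
  shows "\<bar>norm (\<Sum>i<k. a i *\<^sub>R w (r (n i))) - iter_norm 0 (map (\<lambda>a n. a *\<^sub>R w n) (map a [0..<k]))\<bar>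
    \<le> k * \<epsilon> N"
proof -
  define D where "D s = iter_norm (\<Sum>t<s. a t *\<^sub>R w (r (n t))) (map (\<lambda>a n. a *\<^sub>R w n) (map a [s..<k]))" for s
  have "\<bar>D s - D 0\<bar> \<le> s * \<epsilon> N" if "s \<le> k" for s
    using that
  proof (induction s)
    case (Suc s)
    then have s: "s < k" by simp
    \<comment> \<open>The coefficient \<open>a t\<close>, moved to position \<open>n t\<close>; the other positions carry 0.\<close>
    define c where "c i = (\<Sum>t<s. if n t = i then a t else 0)" for i
    have mono: "n t < n s" if "t < s" for t
      using n(1) s that by (auto simp: strict_mono_on_def)
    have inj: "n t = n t' \<longleftrightarrow> t = t'" if "t < s" "t' < s" for t t'
      using strict_mono_on_imp_inj_on[OF n(1)] s that by (auto simp: inj_on_def)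
    have c1: "\<bar>c i\<bar> \<le> 1" for i
    proof (cases "\<exists>t<s. n t = i")
      case True
      then obtain t where t: "t < s" "n t = i" by blast
      have "c i = (\<Sum>t'<s. if t' = t then a t' else 0)"
        unfolding c_def by (rule sum.cong) (use t inj in auto)
      then show ?thesis using t a s by simp
    next
      case False
      then have "c i = 0" unfolding c_def by (intro sum.neutral) auto
      then show ?thesis by simp
    qed
    have "(\<Sum>i<n s. c i *\<^sub>R w (r i)) = (\<Sum>i<n s. \<Sum>t<s. if i = n t then a t *\<^sub>R w (r (n t)) else 0)"
      unfolding c_def scaleR_left.sum by (intro sum.cong refl) auto
    also have "\<dots> = (\<Sum>t<s. a t *\<^sub>R w (r (n t)))"
      by (subst sum.swap, rule sum.cong) (use mono in auto)
    finally have V: "(\<Sum>i<n s. c i *\<^sub>R w (r i)) = (\<Sum>t<s. a t *\<^sub>R w (r (n t)))" .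
    have split: "map a [s..<k] = a s # map a [Suc s..<k]" using s by (simp add: upt_conv_Cons)
    have bd: "\<forall>x\<in>set (a s # map a [Suc s..<k]). \<bar>x\<bar> \<le> 1" using a s by auto
    have len: "length (map a [Suc s..<k]) \<le> n s" using n(2)[OF s] N by simp
    have "\<bar>D (Suc s) - D s\<bar> \<le> \<epsilon> (n s)"
      using approximates_limitsD[OF r _ bd len, of c] c1
      unfolding V D_def split sum.lessThan_Suc by blast
    also have "\<dots> \<le> \<epsilon> N" using \<epsilon> n(2)[OF s] by (auto dest: antimonoD)
    finally show ?case using Suc by (simp add: algebra_simps)
  qed simp
  from this[of k] show ?thesis by (simp add: D_def)
qed

text \<open>
  Grunblum's criterion: the partial sum projections are uniformly bounded on the span, so the
  coefficients extend continuously to the closure.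
\<close>

lemma basic_sequence_criterion:
  fixes x :: "nat \<Rightarrow> 'a::real_normed_vector"
  assumes x: "\<And>i. norm (x i) = 1" and K: "K \<ge> 0"
    and proj: "\<And>c p q. p \<le> q \<Longrightarrow> norm (\<Sum>i<p. c i *\<^sub>R x i) \<le> K * norm (\<Sum>i<q. c i *\<^sub>R x i)"
  shows "basic_sequence x"
proof -
  define S where "S c p = (\<Sum>i<p. c i *\<^sub>R x i)" for c :: "nat \<Rightarrow> real" and p
  have Sdiff: "S (\<lambda>i. c i - d i) p = S c p - S d p" for c d p
    by (simp add: S_def scaleR_diff_left sum_subtractf)
  have coeff: "\<bar>c i\<bar> \<le> 2 * K * norm (S c p)" if "i < p" for c i p
  proof -
    have "\<bar>c i\<bar> = norm (S c (Suc i) - S c i)" by (simp add: S_def x)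
    also have "\<dots> \<le> norm (S c (Suc i)) + norm (S c i)" by (rule norm_triangle_ineq4)
    also have "\<dots> \<le> K * norm (S c p) + K * norm (S c p)"
      unfolding S_def using that by (intro add_mono proj) auto
    finally show ?thesis by simp
  qed
  define T where "T = {v. \<exists>c q. \<forall>p\<ge>q. v = S c p}"
  have "subspace T"
  proof (rule subspaceI)
    show "0 \<in> T" unfolding T_def S_def by (auto intro!: exI[of _ "\<lambda>_. 0"])
  next
    fix u v assume "u \<in> T" "v \<in> T"
    then obtain c q c' q' where "\<forall>p\<ge>q. u = S c p" "\<forall>p\<ge>q'. v = S c' p" by (auto simp: T_def)
    then have "\<forall>p\<ge>max q q'. u + v = S (\<lambda>i. c i + c' i) p"
      by (auto simp: S_def scaleR_add_left sum.distrib)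
    then show "u + v \<in> T" unfolding T_def by blast
  next
    fix a :: real and u assume "u \<in> T"
    then obtain c q where "\<forall>p\<ge>q. u = S c p" by (auto simp: T_def)
    then have "\<forall>p\<ge>q. a *\<^sub>R u = S (\<lambda>i. a * c i) p"
      by (auto simp: S_def scaleR_sum_right)
    then show "a *\<^sub>R u \<in> T" unfolding T_def by blast
  qed
  moreover have "range x \<subseteq> T"
  proof
    fix v assume "v \<in> range x"
    then obtain k where k: "v = x k" by blast
    have "\<forall>p\<ge>Suc k. v = S (\<lambda>i. if i = k then 1 else 0) p"
      by (auto simp: S_def k if_distrib[of "\<lambda>c. c *\<^sub>R _"] cong: if_cong)
    then show "v \<in> T" unfolding T_def by blast
  qed
  ultimately have spanT: "span (range x) \<subseteq> T" by (simp add: span_minimal)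
  show ?thesis
    unfolding basic_sequence_def
  proof (intro ballI ex_ex1I)
    fix v assume "v \<in> closure (span (range x))"
    then obtain s where s: "\<And>k. s k \<in> span (range x)" "s \<longlonglongrightarrow> v"
      unfolding closure_sequential by blast
    then have "\<forall>k. \<exists>c q. \<forall>p\<ge>q. s k = S c p" using spanT unfolding T_def by blast
    then obtain c q where cq: "\<And>k p. p \<ge> q k \<Longrightarrow> s k = S (c k) p" by metis
    have dist_S: "norm (S (c k) p - S (c l) p) \<le> K * norm (s k - s l)" for k l p
    proof -
      define Q where "Q = max p (max (q k) (q l))"
      have "norm (S (\<lambda>i. c k i - c l i) p) \<le> K * norm (S (\<lambda>i. c k i - c l i) Q)"
        unfolding S_def by (rule proj) (simp add: Q_def)
      also have "S (\<lambda>i. c k i - c l i) Q = s k - s l"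
        using cq[of k Q] cq[of l Q] by (simp add: Sdiff Q_def)
      finally show ?thesis by (simp only: Sdiff)
    qed
    have dist_c: "\<bar>c k i - c l i\<bar> \<le> 2 * K * norm (s k - s l)" for k l i
    proof -
      define Q where "Q = max (Suc i) (max (q k) (q l))"
      have "\<bar>c k i - c l i\<bar> \<le> 2 * K * norm (S (\<lambda>i. c k i - c l i) Q)"
        by (rule coeff) (simp add: Q_def)
      also have "S (\<lambda>i. c k i - c l i) Q = s k - s l"
        using cq[of k Q] cq[of l Q] by (simp add: Sdiff Q_def)
      finally show ?thesis .
    qed
    have "Cauchy s" using s(2) by (rule LIMSEQ_imp_Cauchy)
    have "Cauchy (\<lambda>k. c k i)" for i
    proof (rule metric_CauchyI)
      fix e :: real assume e: "e > 0"
      have "e / (2 * K + 1) > 0" using e K by simp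
      then obtain M where M: "\<And>m n. m \<ge> M \<Longrightarrow> n \<ge> M \<Longrightarrow> norm (s m - s n) < e / (2 * K + 1)"
        using CauchyD[OF \<open>Cauchy s\<close>] by blast
      show "\<exists>M. \<forall>m\<ge>M. \<forall>n\<ge>M. dist (c m i) (c n i) < e"
      proof (intro exI allI impI)
        fix m n assume mn: "M \<le> m" "M \<le> n"
        have "dist (c m i) (c n i) \<le> 2 * K * norm (s m - s n)"
          using dist_c by (simp add: dist_real_def)
        also have "\<dots> \<le> (2 * K + 1) * norm (s m - s n)" by (intro mult_right_mono) auto
        also have "\<dots> < e" using M[OF mn] K by (simp add: field_simps)
        finally show "dist (c m i) (c n i) < e" .
      qed
    qed
    then have "convergent (\<lambda>k. c k i)" for i by (rule real_Cauchy_convergent)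
    then have "\<exists>a. \<forall>i. (\<lambda>k. c k i) \<longlonglongrightarrow> a i" unfolding convergent_def by (intro choice allI)
    then obtain a where a: "\<And>i. (\<lambda>k. c k i) \<longlonglongrightarrow> a i" by blast
    have lim_S: "(\<lambda>k. S (c k) p) \<longlonglongrightarrow> S a p" for p
      unfolding S_def by (intro tendsto_intros a)
    have near: "norm (S (c k) p - S a p) \<le> K * norm (s k - v)" for k p
    proof (rule LIMSEQ_le)
      show "(\<lambda>l. norm (S (c k) p - S (c l) p)) \<longlonglongrightarrow> norm (S (c k) p - S a p)"
        by (intro tendsto_intros lim_S)
      show "(\<lambda>l. K * norm (s k - s l)) \<longlonglongrightarrow> K * norm (s k - v)" by (intro tendsto_intros s)
    qed (use dist_S in auto)
    have "S a \<longlonglongrightarrow> v"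
    proof (rule LIMSEQ_I)
      fix e :: real assume e: "e > 0"
      have "e / (K + 1) > 0" using e K by simp
      then obtain k where "norm (s k - v) < e / (K + 1)" using LIMSEQ_D[OF s(2)] by blast
      then have k: "(K + 1) * norm (s k - v) < e" using K by (simp add: field_simps)
      show "\<exists>M. \<forall>p\<ge>M. norm (S a p - v) < e"
      proof (intro exI allI impI)
        fix p assume "q k \<le> p"
        then have "norm (S a p - v) \<le> norm (S (c k) p - S a p) + norm (s k - v)"
          using cq norm_triangle_ineq[of "S a p - S (c k) p" "s k - v"]
          by (simp add: norm_minus_commute)
        also have "\<dots> \<le> (K + 1) * norm (s k - v)" using near[of k p] by (simp add: algebra_simps)
        finally show "norm (S a p - v) < e" using k by simp
      qed
    qed
    then show "\<exists>a. (\<lambda>n. a n *\<^sub>R x n) sums v" unfolding sums_def S_def by blast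
  next
    fix v a b
    assume "(\<lambda>n. a n *\<^sub>R x n) sums v" "(\<lambda>n. b n *\<^sub>R x n) sums v"
    then have "S a \<longlonglongrightarrow> v" "S b \<longlonglongrightarrow> v" unfolding sums_def S_def .
    then have "(\<lambda>p. 2 * K * norm (S a p - S b p)) \<longlonglongrightarrow> 2 * K * norm (v - v)" by (intro tendsto_intros)
    then have lim: "(\<lambda>p. 2 * K * norm (S (\<lambda>i. a i - b i) p)) \<longlonglongrightarrow> 0" by (simp add: Sdiff)
    show "a = b"
    proof
      fix i
      have "\<bar>a i - b i\<bar> \<le> 0"
        by (rule LIMSEQ_le_const[OF lim], rule exI[of _ "Suc i"]) (auto intro: coeff)
      then show "a i = b i" by simp
    qed
  qed
qed

text \<open>
  After rescaling, the largest coefficient has modulus 1. Then two consecutive partial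
  sums differ by a unit vector, so one of them has norm at least \<open>1/2\<close> and the whole
  sum has norm at least \<open>1/4\<close>; this absorbs the additive errors.
\<close>

lemma basic_sequence_of_almost_monotone:
  fixes x :: "nat \<Rightarrow> 'a::real_normed_vector"
  assumes x: "\<And>i. norm (x i) = 1"
    and step: "\<And>j c. (\<And>i. i \<le> j \<Longrightarrow> \<bar>c i\<bar> \<le> 1) \<Longrightarrow>
      norm (\<Sum>i<j. c i *\<^sub>R x i) \<le> norm (\<Sum>i<Suc j. c i *\<^sub>R x i) + (1/2)^j / 8"
  shows "basic_sequence x"
proof (rule basic_sequence_criterion[OF x, of 2])
  fix c :: "nat \<Rightarrow> real" and p q :: nat assume pq: "p \<le> q"
  define M where "M = Max (insert 0 ((\<lambda>i. \<bar>c i\<bar>) ` {..<q}))"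
  have cM: "\<bar>c i\<bar> \<le> M" if "i < q" for i unfolding M_def using that by (intro Max_ge) auto
  show "norm (\<Sum>i<p. c i *\<^sub>R x i) \<le> 2 * norm (\<Sum>i<q. c i *\<^sub>R x i)"
  proof (cases "M = 0")
    case True
    then have "(\<Sum>i<p. c i *\<^sub>R x i) = 0" using cM pq by (intro sum.neutral) fastforce
    then show ?thesis by simp
  next
    case False
    have "M \<in> insert 0 ((\<lambda>i. \<bar>c i\<bar>) ` {..<q})" unfolding M_def by (rule Max_in) auto
    then obtain i0 where i0: "i0 < q" "\<bar>c i0\<bar> = M" using False by auto
    have M: "M > 0" using False i0 by (metis abs_ge_zero order_le_less)
    define d where "d i = c i / M" for i
    have d1: "\<bar>d i\<bar> \<le> 1" if "i < q" for i using cM[OF that] M by (simp add: d_def)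
    define S where "S p = (\<Sum>i<p. d i *\<^sub>R x i)" for p
    define \<eta> where "\<eta> j = (1/2::real)^j" for j :: nat
    have \<eta>: "\<eta> (Suc j) = \<eta> j / 2" "0 \<le> \<eta> j" "\<eta> j \<le> 1" for j
      by (simp_all add: \<eta>_def power_le_one)
    have S: "norm (S p) \<le> norm (S q) + 1/4" if "p \<le> q" for p
    proof -
      have "norm (S p) \<le> norm (S (p + k)) + (\<eta> p - \<eta> (p + k)) / 4" if "p + k \<le> q" for k
        using that
      proof (induction k)
        case (Suc k)
        have "norm (S (p + k)) \<le> norm (S (Suc (p + k))) + \<eta> (p + k) / 8"
          unfolding S_def \<eta>_def by (rule step) (use Suc.prems d1 in auto)
        moreover have "norm (S p) \<le> norm (S (p + k)) + (\<eta> p - \<eta> (p + k)) / 4"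
          using Suc by simp
        ultimately show ?case using \<eta>(1)[of "p + k"] unfolding add_Suc_right by argo
      qed simp
      from this[of "q - p"] have "norm (S p) \<le> norm (S q) + (\<eta> p - \<eta> q) / 4"
        using that by simp
      then show ?thesis using \<eta>(2)[of q] \<eta>(3)[of p] by argo
    qed
    have "1 = norm (S (Suc i0) - S i0)" using i0 M x by (simp add: S_def d_def)
    also have "\<dots> \<le> norm (S (Suc i0)) + norm (S i0)" by (rule norm_triangle_ineq4)
    also have "\<dots> \<le> 2 * (norm (S q) + 1/4)" using S[of "Suc i0"] S[of i0] i0 by simp
    finally have "1/4 \<le> norm (S q)" by simp
    then have "norm (S p) \<le> 2 * norm (S q)" using S[OF pq] by simp
    moreover have "(\<Sum>i<k. c i *\<^sub>R x i) = M *\<^sub>R S k" for k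
      using False by (simp add: S_def d_def scaleR_sum_right)
    ultimately show ?thesis using M by simp
  qed
qed simp

section \<open>Realising iterated norms in l-infinity\<close>

lemma apply_bcontfun_sum:
  fixes k :: nat
  shows "apply_bcontfun (\<Sum>i<k. a i *\<^sub>R (xt i :: l_infinity)) t = (\<Sum>i<k. a i * apply_bcontfun (xt i) t)"
  by (induction k) simp_all

text \<open>
  Coordinate \<open>t\<close> codes a finite list \<open>b\<close> of rational coefficients and is the limit in \<open>M\<close>
  along \<^term>\<open>ultra\<close> of functionals norming \<open>\<Sum> b\<^sub>i x\<^sub>M\<^sub>+\<^sub>i\<close>. Beyond the length of the list the coordinate
  is set to 0; monotonicity of \<^term>\<open>p\<close> makes this harmless.
\<close>

lemma l_infinity_realization:
  fixes x :: "nat \<Rightarrow> 'a::real_normed_vector" and p :: "nat \<Rightarrow> (nat \<Rightarrow> real) \<Rightarrow> real"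
  assumes x: "\<And>i. norm (x i) \<le> 1"
    and lim: "\<And>k a. (\<lambda>M. norm (\<Sum>i<k. a i *\<^sub>R x (M + i))) \<longlonglongrightarrow> p k a"
    and mono: "\<And>k l a. k \<le> l \<Longrightarrow> p k a \<le> p l a"
  shows "\<exists>xt :: nat \<Rightarrow> l_infinity. \<forall>k a. norm (\<Sum>i<k. a i *\<^sub>R xt i) = p k a"
proof -
  define b where "b t i = real_of_rat ((from_nat t :: rat list) ! i)" for t i
  define \<kappa> where "\<kappa> t = length (from_nat t :: rat list)" for t
  have "\<exists>f. contraction_functional f \<and>
      f (\<Sum>i<\<kappa> t. b t i *\<^sub>R x (M + i)) = norm (\<Sum>i<\<kappa> t. b t i *\<^sub>R x (M + i))" for t M
    by (rule norming_functional)
  then obtain F where F: "\<And>t M. contraction_functional (F t M)"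
    "\<And>t M. F t M (\<Sum>i<\<kappa> t. b t i *\<^sub>R x (M + i)) = norm (\<Sum>i<\<kappa> t. b t i *\<^sub>R x (M + i))"
    by metis
  have lin: "linear (F t M)" and bound: "\<bar>F t M v\<bar> \<le> norm v" for t M v
    using F(1) by (auto simp: contraction_functional_def)
  have F_sum: "F t M (\<Sum>i<k. a i *\<^sub>R x (M + i)) = (\<Sum>i<k. a i * F t M (x (M + i)))" for t M k a
    by (simp add: linear_sum[OF lin] linear_scale[OF lin])
  have Fx: "\<bar>F t M (x i)\<bar> \<le> 1" for t M i using bound[of t M "x i"] x[of i] by linarith
  define \<phi> where "\<phi> t i = (if i < \<kappa> t then Lim ultra (\<lambda>M. F t M (x (M + i))) else 0)" for t i
  have \<phi>_lim: "((\<lambda>M. F t M (x (M + i))) \<longlongrightarrow> \<phi> t i) ultra" if "i < \<kappa> t" for t i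
    unfolding \<phi>_def using that
    by (simp, intro ultra_lim boundedI[where B = 1]) (use Fx in auto)
  have \<phi>1: "\<bar>\<phi> t i\<bar> \<le> 1" for t i
  proof (cases "i < \<kappa> t")
    case True
    show ?thesis by (rule ultra_limit_le[OF tendsto_rabs[OF \<phi>_lim[OF True]] tendsto_const Fx])
  qed (simp add: \<phi>_def)
  have sum_lim: "((\<lambda>M. F t M (\<Sum>i<k. a i *\<^sub>R x (M + i))) \<longlongrightarrow> (\<Sum>i<k. a i * \<phi> t i)) ultra"
    if "k \<le> \<kappa> t" for t k a
    unfolding F_sum using that by (intro tendsto_intros \<phi>_lim) auto
  have upper: "\<bar>\<Sum>i<k. a i * \<phi> t i\<bar> \<le> p k a" for t k a
  proof -
    define l where "l = min k (\<kappa> t)"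
    have "(\<Sum>i<k. a i * \<phi> t i) = (\<Sum>i<l. a i * \<phi> t i)"
      by (rule sum.mono_neutral_right) (auto simp: l_def \<phi>_def)
    moreover have "\<bar>\<Sum>i<l. a i * \<phi> t i\<bar> \<le> p l a"
      by (rule ultra_limit_le[OF tendsto_rabs[OF sum_lim] tendsto_ultra[OF lim] bound]) (simp add: l_def)
    moreover have "p l a \<le> p k a" by (rule mono) (simp add: l_def)
    ultimately show ?thesis by simp
  qed
  define xt where "xt i = (Bcontfun (\<lambda>t. \<phi> t i) :: l_infinity)" for i
  have xt: "apply_bcontfun (xt i) t = \<phi> t i" for i t
  proof -
    have "(\<lambda>t. \<phi> t i) \<in> bcontfun" by (rule bcontfun_normI[of _ 1]) (use \<phi>1 in auto)
    then show ?thesis by (simp add: xt_def Bcontfun_inverse)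
  qed
  have "norm (\<Sum>i<k. a i *\<^sub>R xt i) = p k a" for k a
  proof (rule antisym)
    show "norm (\<Sum>i<k. a i *\<^sub>R xt i) \<le> p k a"
      by (rule norm_bound) (simp add: apply_bcontfun_sum xt upper)
    have le: "p k a \<le> norm (\<Sum>i<k. a i *\<^sub>R xt i) + 2 * k * \<delta>" if \<delta>: "\<delta> > 0" for \<delta> :: real
    proof -
      have "\<exists>q. \<bar>real_of_rat q - a i\<bar> < \<delta>" for i
      proof -
        have "a i - \<delta> < a i + \<delta>" using \<delta> by simp
        then obtain q where "a i - \<delta> < real_of_rat q" "real_of_rat q < a i + \<delta>"
          using of_rat_dense by blast
        then show ?thesis by (intro exI[of _ q]) (simp add: abs_less_iff)
      qed
      then obtain q where q: "\<And>i. \<bar>real_of_rat (q i) - a i\<bar> < \<delta>" by metis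
      define t where "t = to_nat (map q [0..<k])"
      have \<kappa>t: "\<kappa> t = k" by (simp add: \<kappa>_def t_def)
      have bt: "\<bar>b t i - a i\<bar> \<le> \<delta>" if "i < k" for i
        using q[of i] that by (simp add: b_def t_def)
      have "p k a \<le> p k (b t) + k * \<delta>"
      proof (rule LIMSEQ_le[OF lim tendsto_add[OF lim tendsto_const]], intro exI allI impI)
        fix M
        have "norm ((\<Sum>i<k. a i *\<^sub>R x (M + i)) - (\<Sum>i<k. b t i *\<^sub>R x (M + i))) \<le> (\<Sum>i<k. \<delta>)"
          unfolding sum_subtractf[symmetric] scaleR_diff_left[symmetric]
        proof (rule sum_norm_le)
          fix i assume "i \<in> {..<k}"
          then have "\<bar>a i - b t i\<bar> * norm (x (M + i)) \<le> \<delta> * 1"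
            using bt[of i] x[of "M + i"] \<delta> by (intro mult_mono) (auto simp: abs_minus_commute)
          then show "norm ((a i - b t i) *\<^sub>R x (M + i)) \<le> \<delta>" by simp
        qed
        then show "norm (\<Sum>i<k. a i *\<^sub>R x (M + i)) \<le> norm (\<Sum>i<k. b t i *\<^sub>R x (M + i)) + k * \<delta>"
          using norm_triangle_sub[of "\<Sum>i<k. a i *\<^sub>R x (M + i)" "\<Sum>i<k. b t i *\<^sub>R x (M + i)"] by simp
      qed
      also have "p k (b t) = (\<Sum>i<k. b t i * \<phi> t i)"
      proof (rule tendsto_unique[OF ultra_nonbot])
        show "((\<lambda>M. norm (\<Sum>i<k. b t i *\<^sub>R x (M + i))) \<longlongrightarrow> p k (b t)) ultra"
          by (rule tendsto_ultra[OF lim])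
        show "((\<lambda>M. norm (\<Sum>i<k. b t i *\<^sub>R x (M + i))) \<longlongrightarrow> (\<Sum>i<k. b t i * \<phi> t i)) ultra"
          using sum_lim[of k t "b t"] F(2)[of t] \<kappa>t by simp
      qed
      also have "(\<Sum>i<k. b t i * \<phi> t i) \<le> (\<Sum>i<k. a i * \<phi> t i) + k * \<delta>"
      proof -
        have "(\<Sum>i<k. b t i * \<phi> t i) - (\<Sum>i<k. a i * \<phi> t i) = (\<Sum>i<k. (b t i - a i) * \<phi> t i)"
          by (simp add: sum_subtractf left_diff_distrib)
        also have "\<dots> \<le> (\<Sum>i<k. \<delta>)"
        proof (rule sum_mono)
          fix i assume "i \<in> {..<k}"
          then have "\<bar>b t i - a i\<bar> * \<bar>\<phi> t i\<bar> \<le> \<delta> * 1"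
            using bt[of i] \<phi>1[of t i] \<delta> by (intro mult_mono) auto
          then show "(b t i - a i) * \<phi> t i \<le> \<delta>" by (simp add: abs_mult[symmetric])
        qed
        finally show ?thesis by simp
      qed
      also have "(\<Sum>i<k. a i * \<phi> t i) \<le> norm (\<Sum>i<k. a i *\<^sub>R xt i)"
        using norm_bounded[of "\<Sum>i<k. a i *\<^sub>R xt i" t] by (simp add: apply_bcontfun_sum xt)
      finally show ?thesis by (simp add: algebra_simps)
    qed
    show "p k a \<le> norm (\<Sum>i<k. a i *\<^sub>R xt i)"
    proof (rule field_le_epsilon)
      fix e :: real assume e: "e > 0"
      have "p k a \<le> norm (\<Sum>i<k. a i *\<^sub>R xt i) + 2 * k * (e / (2 * k + 1))" using e by (intro le) simp
      also have "2 * k * (e / (2 * k + 1)) \<le> e" using e by (simp add: field_simps)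
      finally show "p k a \<le> norm (\<Sum>i<k. a i *\<^sub>R xt i) + e" by simp
    qed
  qed
  then show ?thesis by blast
qed

section \<open>Upper estimates from spreading models\<close>

definition only_c0_spreading_models :: "'a::real_normed_vector itself \<Rightarrow> bool" where
  "only_c0_spreading_models (_ :: 'a itself) \<longleftrightarrow> (\<forall>(x :: nat \<Rightarrow> 'a) (xt :: nat \<Rightarrow> l_infinity).
    normalized x \<longrightarrow> weakly_null x \<longrightarrow> spreading_model xt x \<longrightarrow> equivalent_sequences xt c0_unit)"

lemma norm_c0_unit_sum_le:
  fixes a :: "nat \<Rightarrow> real"
  assumes "\<And>i. \<bar>a i\<bar> \<le> 1" "finite A"
  shows "norm (\<Sum>i\<in>A. a i *\<^sub>R c0_unit i) \<le> 1"
proof (rule norm_bound)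
  fix j
  have "apply_bcontfun (\<Sum>i\<in>A. a i *\<^sub>R c0_unit i) j = (\<Sum>i\<in>A. if i = j then a i else 0)"
    using assms(2) by (induction A) (auto simp: apply_c0_unit)
  also have "\<dots> = (if j \<in> A then a j else 0)" using assms(2) by simp
  finally show "norm (apply_bcontfun (\<Sum>i\<in>A. a i *\<^sub>R c0_unit i) j) \<le> 1" using assms(1) by simp
qed

lemma finite_list_sum_bound:
  fixes w :: "nat \<Rightarrow> 'a::real_normed_vector"
  assumes "\<And>a k. (\<And>i. \<bar>a i\<bar> \<le> 1) \<Longrightarrow> iter_norm 0 (map (\<lambda>a n. a *\<^sub>R w n) (map a [0..<k])) \<le> B"
    and "\<forall>a\<in>set as. \<bar>a\<bar> \<le> 1"
  shows "iter_norm 0 (map (\<lambda>a n. a *\<^sub>R w n) as) \<le> B"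
proof -
  define a where "a i = (if i < length as then as ! i else 0)" for i
  have "\<bar>a i\<bar> \<le> 1" for i using assms(2) by (auto simp: a_def)
  from assms(1)[OF this, where k = "length as"]
  have "iter_norm 0 (map (\<lambda>a n. a *\<^sub>R w n) (map a [0..<length as])) \<le> B" .
  moreover have "map a [0..<length as] = as"
    by (rule nth_equalityI) (simp_all add: a_def)
  ultimately show ?thesis by simp
qed

text \<open>
  A subsequence that approximates the limits quickly enough is basic, and its spreading model,
  realised in \<open>\<ell>\<^sup>\<infinity>\<close>, has the iterated norms of \<^term>\<open>w\<close> as its norm. Equivalence with the unit
  vector basis of \<open>c\<^sub>0\<close> then bounds these uniformly over bounded coefficients.
\<close>

lemma spreading_subsequence_bound:
  fixes w :: "nat \<Rightarrow> 'a::real_normed_vector"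
  assumes c0: "only_c0_spreading_models TYPE('a)"
    and w: "weakly_null w" "\<And>n. norm (w n) \<le> 1" "\<forall>\<^sub>F n in ultra. norm (w n) = 1"
  shows "\<exists>K. \<forall>as. (\<forall>a\<in>set as. \<bar>a\<bar> \<le> 1) \<longrightarrow> iter_norm 0 (map (\<lambda>a n. a *\<^sub>R w n) as) \<le> K"
proof -
  \<comment> \<open>The errors add up to \<open>1/4\<close>, which \<open>basic_sequence_of_almost_monotone\<close> can absorb.\<close>
  define \<epsilon> where "\<epsilon> j = (1/2::real)^j / 8" for j :: nat
  have \<epsilon>: "antimono \<epsilon>" by (auto simp: antimono_def \<epsilon>_def power_decreasing)
  obtain r where r: "strict_mono r" "\<And>j. norm (w (r j)) = 1" "approximates_limits w r \<epsilon>"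
    using exists_approximating_subsequence[OF w(2,3), of \<epsilon>] by (auto simp: \<epsilon>_def)
  define x where "x j = w (r j)" for j
  define p where "p k a = iter_norm 0 (map (\<lambda>a n. a *\<^sub>R w n) (map a [0..<k]))" for k and a :: "nat \<Rightarrow> real"
  have wn: "weakly_null (\<lambda>n. a *\<^sub>R w n)" for a by (rule weakly_null_scaleR[OF w(1)])
  have bd: "bounded (range (\<lambda>n. a *\<^sub>R w n))" for a by (rule weakly_null_bounded[OF wn])
  have normx: "norm (x j) = 1" for j by (simp add: x_def r)
  have spread: "\<bar>norm (\<Sum>i<k. a i *\<^sub>R x (n i)) - p k a\<bar> \<le> k * \<epsilon> N"
    if "strict_mono_on {..<k} n" "\<And>i. i < k \<Longrightarrow> N \<le> n i" "k \<le> N" "\<And>i. i < k \<Longrightarrow> \<bar>a i\<bar> \<le> 1"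
    for k n a N
    unfolding x_def p_def by (rule approximates_limits_spread[OF r(3) \<epsilon> that])
  have \<epsilon>0: "\<epsilon> \<longlonglongrightarrow> 0" unfolding \<epsilon>_def
    by (rule tendsto_eq_rhs[OF tendsto_divide[OF LIMSEQ_realpow_zero tendsto_const]]) auto
  have lim1: "(\<lambda>M. norm (\<Sum>i<k. a i *\<^sub>R x (M + i))) \<longlonglongrightarrow> p k a" if a: "\<And>i. i < k \<Longrightarrow> \<bar>a i\<bar> \<le> 1" for k a
  proof (rule LIM_zero_cancel, rule Lim_null_comparison)
    show "\<forall>\<^sub>F M in sequentially. norm (norm (\<Sum>i<k. a i *\<^sub>R x (M + i)) - p k a) \<le> k * \<epsilon> M"
      using eventually_ge_at_top[of k]
      by eventually_elim (use a in \<open>auto intro!: spread simp: strict_mono_on_def\<close>)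
    show "(\<lambda>M. k * \<epsilon> M) \<longlonglongrightarrow> 0" by (rule tendsto_eq_rhs[OF tendsto_mult[OF tendsto_const \<epsilon>0]]) simp
  qed
  have p_scale: "p k (\<lambda>i. c * a i) = \<bar>c\<bar> * p k a" for c k a
    using iter_norm_scaleR[of "[0..<k]" "\<lambda>i n. a i *\<^sub>R w n" c 0] bd
    by (simp add: p_def comp_def)
  have "\<exists>xt :: nat \<Rightarrow> l_infinity. \<forall>k a. norm (\<Sum>i<k. a i *\<^sub>R xt i) = p k a"
  proof (rule l_infinity_realization)
    show "(\<lambda>M. norm (\<Sum>i<k. a i *\<^sub>R x (M + i))) \<longlonglongrightarrow> p k a" for k a
    proof -
      define c where "c = 1 + (\<Sum>i<k. \<bar>a i\<bar>)"
      have c: "c > 0" unfolding c_def by (intro add_pos_nonneg sum_nonneg) auto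
      have "\<bar>a i\<bar> \<le> c" if "i < k" for i
        using member_le_sum[of i "{..<k}" "\<lambda>i. \<bar>a i\<bar>"] that by (simp add: c_def)
      then have "(\<lambda>M. norm (\<Sum>i<k. (inverse c * a i) *\<^sub>R x (M + i))) \<longlonglongrightarrow> p k (\<lambda>i. inverse c * a i)"
        using c by (intro lim1) (simp add: abs_mult field_simps)
      then have "(\<lambda>M. c * norm (\<Sum>i<k. (inverse c * a i) *\<^sub>R x (M + i))) \<longlonglongrightarrow> c * (inverse c * p k a)"
        unfolding p_scale using c by (intro tendsto_intros) simp
      moreover have "c * norm (\<Sum>i<k. (inverse c * a i) *\<^sub>R x (M + i)) = norm (\<Sum>i<k. a i *\<^sub>R x (M + i))" for M
      proof -
        have "(\<Sum>i<k. a i *\<^sub>R x (M + i)) = c *\<^sub>R (\<Sum>i<k. (inverse c * a i) *\<^sub>R x (M + i))"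
          using c by (simp add: scaleR_sum_right mult.assoc[symmetric])
        then show ?thesis using c by simp
      qed
      ultimately show ?thesis using c by (simp add: mult.assoc[symmetric])
    qed
    show "p k a \<le> p l a" if "k \<le> l" for k l a
    proof -
      have "[0..<l] = [0..<k] @ [k..<l]" using upt_add_eq_append[of 0 k "l - k"] that by simp
      then show ?thesis
        unfolding p_def by (simp only: map_append) (rule iter_norm_append_ge; use bd wn in auto)
    qed
  qed (simp add: normx)
  then obtain xt :: "nat \<Rightarrow> l_infinity" where xt: "\<And>k a. norm (\<Sum>i<k. a i *\<^sub>R xt i) = p k a" by blast
  have basic: "basic_sequence x"
  proof (rule basic_sequence_of_almost_monotone[OF normx])
    fix j and c :: "nat \<Rightarrow> real" assume c: "\<And>i. i \<le> j \<Longrightarrow> \<bar>c i\<bar> \<le> 1"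
    let ?V = "\<Sum>i<j. c i *\<^sub>R w (r i)"
    have "\<bar>iter_norm (?V + c j *\<^sub>R w (r j)) (map (\<lambda>a n. a *\<^sub>R w n) [])
        - iter_norm ?V (map (\<lambda>a n. a *\<^sub>R w n) [c j])\<bar> \<le> \<epsilon> j"
      by (rule approximates_limitsD[OF r(3)]) (use c in auto)
    moreover have "iter_norm ?V [] \<le> iter_norm ?V (map (\<lambda>a n. a *\<^sub>R w n) [c j])"
      unfolding list.map by (rule iter_norm_Cons_ge[OF wn]) simp
    ultimately have "norm ?V \<le> norm (?V + c j *\<^sub>R w (r j)) + \<epsilon> j"
      by (simp only: list.map iter_norm.simps(1) abs_le_iff) argo
    then show "norm (\<Sum>i<j. c i *\<^sub>R x i) \<le> norm (\<Sum>i<Suc j. c i *\<^sub>R x i) + (1/2)^j / 8"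
      by (simp add: x_def \<epsilon>_def)
  qed
  have "spreading_model xt x"
    unfolding spreading_model_def
  proof (intro conjI allI impI)
    show "normalized x" by (simp add: normalized_def normx)
    show "basic_sequence x" by (rule basic)
    fix e :: real and k :: nat assume e: "e > 0"
    have "(\<lambda>N. k * \<epsilon> N) \<longlonglongrightarrow> 0" by (rule tendsto_eq_rhs[OF tendsto_mult[OF tendsto_const \<epsilon>0]]) simp
    then have "\<forall>\<^sub>F N in sequentially. k * \<epsilon> N < e" using e by (rule order_tendstoD(2))
    then have "\<forall>\<^sub>F N in sequentially. k * \<epsilon> N < e \<and> k \<le> N"
      using eventually_ge_at_top by (rule eventually_conj)
    then obtain N where N: "k * \<epsilon> N < e" "k \<le> N" unfolding eventually_sequentially by blast
    show "\<exists>N. \<forall>n. strict_mono_on {..<k} n \<and> (\<forall>i<k. N \<le> n i) \<longrightarrow>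
        (\<forall>a. (\<forall>i<k. \<bar>a i\<bar> \<le> 1) \<longrightarrow>
          \<bar>norm (\<Sum>i<k. a i *\<^sub>R x (n i)) - norm (\<Sum>i<k. a i *\<^sub>R xt i)\<bar> < e)"
    proof (intro exI[of _ N] allI impI)
      fix n :: "nat \<Rightarrow> nat" and a :: "nat \<Rightarrow> real"
      assume "strict_mono_on {..<k} n \<and> (\<forall>i<k. N \<le> n i)" "\<forall>i<k. \<bar>a i\<bar> \<le> 1"
      then have "\<bar>norm (\<Sum>i<k. a i *\<^sub>R x (n i)) - p k a\<bar> \<le> k * \<epsilon> N" using N by (intro spread) auto
      then show "\<bar>norm (\<Sum>i<k. a i *\<^sub>R x (n i)) - norm (\<Sum>i<k. a i *\<^sub>R xt i)\<bar> < e"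
        using N xt by simp
    qed
  qed
  moreover have "weakly_null x" unfolding x_def
    by (rule weakly_null_compose[OF w(1) filterlim_subseq[OF r(1)]])
  moreover have "normalized x" by (simp add: normalized_def normx)
  ultimately have "equivalent_sequences xt c0_unit" using c0 unfolding only_c0_spreading_models_def by blast
  then obtain B where B: "B > 0" "\<And>a. finite {i. a i \<noteq> 0} \<Longrightarrow>
      norm (\<Sum>i | a i \<noteq> 0. a i *\<^sub>R xt i) \<le> B * norm (\<Sum>i | a i \<noteq> 0. a i *\<^sub>R c0_unit i)"
    unfolding equivalent_sequences_def by blast
  have pB: "p k a \<le> B" if a: "\<And>i. \<bar>a i\<bar> \<le> 1" for k a
  proof -
    define a' where "a' i = (if i < k then a i else 0)" for i
    have fin: "finite {i. a' i \<noteq> 0}" by (rule finite_subset[of _ "{..<k}"]) (auto simp: a'_def)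
    have "(\<Sum>i<k. a i *\<^sub>R xt i) = (\<Sum>i | a' i \<noteq> 0. a' i *\<^sub>R xt i)"
      by (rule sum.mono_neutral_cong_right) (auto simp: a'_def)
    then have "p k a \<le> B * norm (\<Sum>i | a' i \<noteq> 0. a' i *\<^sub>R c0_unit i)"
      using B(2)[OF fin] xt[of a k] by simp
    also have "\<dots> \<le> B * 1"
      using B(1) a fin by (intro mult_left_mono norm_c0_unit_sum_le) (auto simp: a'_def)
    finally show ?thesis by simp
  qed
  have "iter_norm 0 (map (\<lambda>a n. a *\<^sub>R w n) as) \<le> B" if as: "\<forall>a\<in>set as. \<bar>a\<bar> \<le> 1" for as
    by (rule finite_list_sum_bound[OF pB[unfolded p_def] as])
  then show ?thesis by blast
qed

text \<open>
  Normalise: along \<^term>\<open>ultra\<close> the norms converge to some \<open>\<beta>\<close>, and if \<open>\<beta> > 0\<close> then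
  \<open>z n\<close> may be replaced by \<open>\<beta> w n\<close> with \<open>w n\<close> a unit vector. Terms of small norm
  are replaced by 0, to keep \<open>w\<close> weakly null.
\<close>

lemma weakly_null_sums_bounded:
  fixes z :: "nat \<Rightarrow> 'a::real_normed_vector"
  assumes c0: "only_c0_spreading_models TYPE('a)"
    and z: "weakly_null z"
  shows "\<exists>K. \<forall>as. (\<forall>a\<in>set as. \<bar>a\<bar> \<le> 1) \<longrightarrow> iter_norm 0 (map (\<lambda>a n. a *\<^sub>R z n) as) \<le> K"
proof -
  define \<beta> where "\<beta> = Lim ultra (\<lambda>n. norm (z n))"
  have bz: "bounded (range z)" by (rule weakly_null_bounded[OF z])
  have \<beta>: "((\<lambda>n. norm (z n)) \<longlongrightarrow> \<beta>) ultra"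
    unfolding \<beta>_def by (rule ultra_lim) (use bz in \<open>simp add: bounded_norm_comp\<close>)
  have near: "\<forall>\<^sub>F n in ultra. \<bar>norm (z n) - \<beta>\<bar> < e" if "e > 0" for e
    using tendstoD[OF \<beta> that] by (simp add: dist_real_def)
  have "\<beta> \<ge> 0" by (rule ultra_limit_le[OF tendsto_const \<beta>]) simp
  define w where "w n = (if norm (z n) < \<beta> / 2 \<or> \<beta> = 0 then 0 else z n /\<^sub>R norm (z n))" for n
  have wn: "weakly_null w"
    unfolding weakly_null_def
  proof (intro allI impI)
    fix f :: "'a \<Rightarrow> real" assume f: "bounded_linear f"
    show "(\<lambda>n. f (w n)) \<longlonglongrightarrow> 0"
    proof (rule Lim_null_comparison)
      show "(\<lambda>n. 2 / \<beta> * \<bar>f (z n)\<bar>) \<longlonglongrightarrow> 0"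
        by (intro tendsto_mult_right_zero tendsto_rabs_zero weakly_nullD[OF z f])
      have "\<bar>f (w n)\<bar> \<le> 2 / \<beta> * \<bar>f (z n)\<bar>" for n
      proof (cases "norm (z n) < \<beta> / 2 \<or> \<beta> = 0")
        case True
        then show ?thesis using f \<open>\<beta> \<ge> 0\<close> by (simp add: w_def linear_0[OF bounded_linear.linear])
      next
        case False
        then have "inverse (norm (z n)) \<le> 2 / \<beta>"
          using \<open>\<beta> \<ge> 0\<close> le_imp_inverse_le[of "\<beta> / 2" "norm (z n)"] by simp
        then have "inverse (norm (z n)) * \<bar>f (z n)\<bar> \<le> 2 / \<beta> * \<bar>f (z n)\<bar>" by (rule mult_right_mono) simp
        then show ?thesis using False f
          by (simp add: w_def linear_scale[OF bounded_linear.linear] abs_mult)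
      qed
      then show "\<forall>\<^sub>F n in sequentially. norm (f (w n)) \<le> 2 / \<beta> * \<bar>f (z n)\<bar>" by simp
    qed
  qed
  have w1: "norm (w n) \<le> 1" for n by (cases "z n = 0") (simp_all add: w_def)
  have bw: "bounded (range w)" by (rule weakly_null_bounded[OF wn])
  have zw: "\<forall>\<^sub>F n in ultra. norm (a *\<^sub>R z n - \<beta> *\<^sub>R a *\<^sub>R w n) \<le> e" if e: "e > 0" and a: "\<bar>a\<bar> \<le> 1" for a e
  proof (cases "\<beta> = 0")
    case True
    from near[OF e] show ?thesis
    proof eventually_elim
      case (elim n)
      have "\<bar>a\<bar> * norm (z n) \<le> 1 * norm (z n)" using a by (intro mult_right_mono) auto
      then show ?case using elim True by simp
    qed
  next
    case False
    then have "\<beta> > 0" using \<open>\<beta> \<ge> 0\<close> by simp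
    then have "\<beta> / 2 > 0" by simp
    from near[OF e] near[OF this] show ?thesis
    proof eventually_elim
      case (elim n)
      then have n: "\<not> norm (z n) < \<beta> / 2" "norm (z n) \<noteq> 0" using \<open>\<beta> > 0\<close> by (auto simp: abs_if split: if_splits)
      have "a *\<^sub>R z n - \<beta> *\<^sub>R a *\<^sub>R w n = (a * (norm (z n) - \<beta>)) *\<^sub>R w n"
        using n False by (simp add: w_def algebra_simps)
      then have "norm (a *\<^sub>R z n - \<beta> *\<^sub>R a *\<^sub>R w n) = \<bar>a\<bar> * \<bar>norm (z n) - \<beta>\<bar> * norm (w n)"
        by (simp add: abs_mult)
      also have "\<dots> \<le> 1 * e * 1" using elim(1) a w1 by (intro mult_mono) auto
      finally show ?case by simp
    qed
  qed
  have compare: "iter_norm 0 (map (\<lambda>a n. a *\<^sub>R z n) as) \<le> \<beta> * iter_norm 0 (map (\<lambda>a n. a *\<^sub>R w n) as)"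
    if as: "\<forall>a\<in>set as. \<bar>a\<bar> \<le> 1" for as
  proof (rule field_le_epsilon)
    fix e :: real assume e: "e > 0"
    define \<delta> where "\<delta> = e / (length as + 1)"
    have \<delta>: "\<delta> > 0" using e by (simp add: \<delta>_def)
    have "iter_norm 0 (map (\<lambda>a n. a *\<^sub>R z n) as)
        \<le> iter_norm 0 (map (\<lambda>a n. \<beta> *\<^sub>R a *\<^sub>R w n) as) + (norm (0 - 0 :: 'a) + (\<Sum>a\<leftarrow>as. \<delta>))"
      by (rule iter_norm_perturb) (use zw[OF \<delta>] as bz bw in \<open>auto intro!: bounded_range_scaleR\<close>)
    also have "(\<Sum>a\<leftarrow>as. \<delta>) \<le> e" using e by (simp add: \<delta>_def sum_list_triv field_simps)
    also have "iter_norm 0 (map (\<lambda>a n. \<beta> *\<^sub>R a *\<^sub>R w n) as) = \<beta> * iter_norm 0 (map (\<lambda>a n. a *\<^sub>R w n) as)"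
      using iter_norm_scaleR[of as "\<lambda>a n. a *\<^sub>R w n" \<beta> 0] bw \<open>\<beta> \<ge> 0\<close>
      by (simp add: bounded_range_scaleR)
    finally show "iter_norm 0 (map (\<lambda>a n. a *\<^sub>R z n) as) \<le> \<beta> * iter_norm 0 (map (\<lambda>a n. a *\<^sub>R w n) as) + e"
      by simp
  qed
  show ?thesis
  proof (cases "\<beta> = 0")
    case True
    then show ?thesis using compare by (intro exI[of _ 0]) auto
  next
    case False
    then have "\<beta> > 0" using \<open>\<beta> \<ge> 0\<close> by simp
    then have "\<beta> / 2 > 0" by simp
    from near[OF this] have "\<forall>\<^sub>F n in ultra. norm (w n) = 1"
    proof eventually_elim
      case (elim n)
      then have "\<not> norm (z n) < \<beta> / 2" "norm (z n) \<noteq> 0" using \<open>\<beta> > 0\<close> by (auto simp: abs_if split: if_splits)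
      then show ?case using False by (simp add: w_def)
    qed
    from spreading_subsequence_bound[OF c0 wn w1 this] obtain K where
      K: "\<And>as. (\<forall>a\<in>set as. \<bar>a\<bar> \<le> 1) \<Longrightarrow> iter_norm 0 (map (\<lambda>a n. a *\<^sub>R w n) as) \<le> K" by blast
    have "iter_norm 0 (map (\<lambda>a n. a *\<^sub>R z n) as) \<le> \<beta> * K" if "\<forall>a\<in>set as. \<bar>a\<bar> \<le> 1" for as
      using compare[OF that] mult_left_mono[OF K[OF that] \<open>\<beta> \<ge> 0\<close>] by linarith
    then show ?thesis by blast
  qed
qed

text \<open>
  The weakly null sequences form a complete subspace of the bounded sequences, and
  \<open>z \<mapsto> iter_norm 0 [a\<^sub>1 z, \<dots>, a\<^sub>k z]\<close> is a continuous seminorm on it. The constants, finite for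
  each \<open>z\<close>, are therefore uniform.
\<close>

lemma weakly_null_sums_uniformly_bounded:
  assumes c0: "only_c0_spreading_models TYPE('a::banach)"
  shows "\<exists>K. \<forall>(z :: nat \<Rightarrow> 'a) as. weakly_null z \<longrightarrow> (\<forall>n. norm (z n) \<le> 1) \<longrightarrow>
    (\<forall>a\<in>set as. \<bar>a\<bar> \<le> 1) \<longrightarrow> iter_norm 0 (map (\<lambda>a n. a *\<^sub>R z n) as) \<le> K"
proof -
  define S where "S = {Y :: nat \<Rightarrow>\<^sub>C 'a. weakly_null (apply_bcontfun Y)}"
  define p where "p as Y = (if \<forall>a\<in>set as. \<bar>a\<bar> \<le> 1
    then iter_norm 0 (map (\<lambda>a n. a *\<^sub>R apply_bcontfun Y n) as) else 0)" for as and Y :: "nat \<Rightarrow>\<^sub>C 'a"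
  have bd: "bounded (range (\<lambda>n. a *\<^sub>R apply_bcontfun Y n))" for a and Y :: "nat \<Rightarrow>\<^sub>C 'a"
    by (rule bounded_range_scaleR) simp
  have "\<exists>K. \<forall>as. \<forall>Y\<in>S. norm Y \<le> 1 \<longrightarrow> p as Y \<le> K"
  proof (rule uniform_boundedness)
    show "subspace S"
      unfolding S_def
      by (rule subspaceI) (auto intro: weakly_null_add weakly_null_scaleR weakly_null_zero)
    show "complete S"
      unfolding complete_def
    proof (intro allI impI, elim conjE)
      fix Y :: "nat \<Rightarrow> nat \<Rightarrow>\<^sub>C 'a" assume YS: "\<forall>k. Y k \<in> S" and "Cauchy Y"
      then obtain g where "uniform_limit UNIV (\<lambda>k. apply_bcontfun (Y k)) g sequentially"
        using uniformly_convergent_eq_cauchy[of "\<lambda>_. True" "\<lambda>k. apply_bcontfun (Y k)"]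
        unfolding Cauchy_def uniform_limit_sequentially_iff by (metis dist_fun_lt_imp_dist_val_lt)
      then obtain l where l: "Y \<longlonglongrightarrow> l" by (rule uniform_limit_bcontfunE) simp
      note Y = YS l
      have "(\<lambda>n. f (apply_bcontfun l n)) \<longlonglongrightarrow> 0" if f: "bounded_linear f" for f :: "'a \<Rightarrow> real"
      proof (rule LIMSEQ_I)
        fix e :: real assume e: "e > 0"
        obtain B where B: "B > 0" "\<And>v. norm (f v) \<le> norm v * B"
          using bounded_linear.pos_bounded[OF f] by blast
        have "e / (2 * B) > 0" using e B by simp
        then obtain k where "norm (Y k - l) < e / (2 * B)" using LIMSEQ_D[OF Y(2)] by blast
        then have k: "norm (Y k - l) * B < e / 2" using B by (simp add: field_simps)
        have "(\<lambda>n. f (apply_bcontfun (Y k) n)) \<longlonglongrightarrow> 0"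
          using Y(1) f by (auto simp: S_def intro: weakly_nullD)
        then obtain N where N: "\<And>n. n \<ge> N \<Longrightarrow> \<bar>f (apply_bcontfun (Y k) n)\<bar> < e / 2"
          using LIMSEQ_D[of _ 0 "e / 2"] e by fastforce
        show "\<exists>N. \<forall>n\<ge>N. norm (f (apply_bcontfun l n) - 0) < e"
        proof (intro exI allI impI)
          fix n assume n: "n \<ge> N"
          have "\<bar>f (apply_bcontfun (Y k - l) n)\<bar> \<le> norm (apply_bcontfun (Y k - l) n) * B"
            using B(2) by simp
          also have "\<dots> \<le> norm (Y k - l) * B" using B(1) by (intro mult_right_mono norm_bounded) simp
          finally have "\<bar>f (apply_bcontfun (Y k) n) - f (apply_bcontfun l n)\<bar> < e / 2"
            using k by (simp add: linear_diff[OF bounded_linear.linear[OF f]])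
          then show "norm (f (apply_bcontfun l n) - 0) < e"
            using N[OF n] abs_triangle_ineq4[of "f (apply_bcontfun (Y k) n)"
                "f (apply_bcontfun (Y k) n) - f (apply_bcontfun l n)"]
            by (simp only: real_norm_def diff_zero diff_diff_eq2 add_diff_cancel_left')
        qed
      qed
      then have "l \<in> S" by (simp add: S_def weakly_null_def)
      with l show "\<exists>l\<in>S. Y \<longlonglongrightarrow> l" by blast
    qed
    show "p as (X + Y) \<le> p as X + p as Y" for as X Y
      using iter_norm_add[of as "\<lambda>a n. a *\<^sub>R apply_bcontfun X n" "\<lambda>a n. a *\<^sub>R apply_bcontfun Y n" 0 0] bd
      by (simp add: p_def scaleR_add_right)
    show "p as (c *\<^sub>R Y) = \<bar>c\<bar> * p as Y" for as c Y
      using iter_norm_scaleR[of as "\<lambda>a n. a *\<^sub>R apply_bcontfun Y n" c 0] bd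
      by (simp add: p_def mult.commute)
    show "\<exists>M. \<forall>Y\<in>S. p as Y \<le> M * norm Y" for as
    proof (intro exI ballI)
      fix Y :: "nat \<Rightarrow>\<^sub>C 'a"
      have "iter_norm 0 (map (\<lambda>a n. a *\<^sub>R apply_bcontfun Y n) as) \<le> norm (0::'a) + (\<Sum>a\<leftarrow>as. norm Y)"
        if "\<forall>a\<in>set as. \<bar>a\<bar> \<le> 1"
      proof (rule iter_norm_le_sum_list)
        show "bounded (range (\<lambda>n. a *\<^sub>R apply_bcontfun Y n))" for a by (rule bd)
        fix a assume "a \<in> set as"
        then have "\<bar>a\<bar> * norm (apply_bcontfun Y n) \<le> 1 * norm Y" for n
          using that by (intro mult_mono norm_bounded) auto
        then show "\<forall>\<^sub>F n in ultra. norm (a *\<^sub>R apply_bcontfun Y n) \<le> norm Y" by simp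
      qed
      then show "p as Y \<le> length as * norm Y" by (auto simp: p_def sum_list_triv)
    qed
    show "\<exists>K. \<forall>as. p as Y \<le> K" if "Y \<in> S" for Y
    proof -
      have "weakly_null (apply_bcontfun Y)" using that by (simp add: S_def)
      from weakly_null_sums_bounded[OF c0 this] obtain K where
        K: "\<And>as. (\<forall>a\<in>set as. \<bar>a\<bar> \<le> 1) \<Longrightarrow> iter_norm 0 (map (\<lambda>a n. a *\<^sub>R apply_bcontfun Y n) as) \<le> K"
        by blast
      then have "p as Y \<le> max K 0" for as by (auto simp: p_def intro: le_max_iff_disj[THEN iffD2])
      then show ?thesis by blast
    qed
  qed
  then obtain K where K: "\<And>as Y. Y \<in> S \<Longrightarrow> norm Y \<le> 1 \<Longrightarrow> p as Y \<le> K" by blast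
  have "iter_norm 0 (map (\<lambda>a n. a *\<^sub>R z n) as) \<le> K"
    if z: "weakly_null z" "\<forall>n. norm (z n) \<le> 1" and as: "\<forall>a\<in>set as. \<bar>a\<bar> \<le> 1" for z :: "nat \<Rightarrow> 'a" and as
  proof -
    have "z \<in> bcontfun" by (rule bcontfun_normI[of _ 1]) (use z in auto)
    then obtain Y where Y: "z = apply_bcontfun Y" by (rule bcontfunE)
    have "p as Y \<le> K" by (rule K) (use z Y in \<open>auto simp: S_def intro: norm_bound\<close>)
    then show ?thesis using as by (simp add: p_def Y)
  qed
  then show ?thesis by blast
qed

section \<open>Permuting the order of the limits\<close>

text \<open>
  An iterated limit that exists may be computed along any subsequences, in particular along
  \<^term>\<open>ultra\<close>.
\<close>

lemma has_iterated_lim_iter_norm: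
  assumes "has_iterated_lim (\<lambda>n. norm (\<Sum>i<m. x i (n i))) ss n L" "distinct ss" "set ss \<subseteq> {..<m}"
    and \<phi>: "\<And>i. i < m \<Longrightarrow> filterlim (\<phi> i) sequentially sequentially"
  shows "iter_norm (\<Sum>i\<in>{..<m} - set ss. x i (n i)) (map (\<lambda>i k. x i (\<phi> i k)) ss) = L"
  using assms(1-3)
proof (induction ss arbitrary: n L)
  case (Cons s ss)
  let ?zs = "map (\<lambda>i k. x i (\<phi> i k)) ss"
  let ?v = "\<Sum>i\<in>{..<m} - set (s # ss). x i (n i)"
  obtain g where g: "\<forall>\<^sub>F k in sequentially.
      has_iterated_lim (\<lambda>n. norm (\<Sum>i<m. x i (n i))) ss (n(s := k)) (g k)" "g \<longlonglongrightarrow> L"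
    using Cons.prems(1) by auto
  have s: "s < m" "s \<notin> set ss" using Cons.prems by auto
  have IH: "iter_norm (?v + x s k) ?zs = g k"
    if "has_iterated_lim (\<lambda>n. norm (\<Sum>i<m. x i (n i))) ss (n(s := k)) (g k)" for k
  proof -
    have split: "{..<m} - set ss = insert s ({..<m} - set (s # ss))" using s by auto
    have "(\<Sum>i\<in>{..<m} - set ss. x i ((n(s := k)) i))
        = x s k + (\<Sum>i\<in>{..<m} - set (s # ss). x i ((n(s := k)) i))"
      unfolding split by (subst sum.insert) simp_all
    also have "(\<Sum>i\<in>{..<m} - set (s # ss). x i ((n(s := k)) i)) = ?v"
      by (rule sum.cong) auto
    finally have "(\<Sum>i\<in>{..<m} - set ss. x i ((n(s := k)) i)) = x s k + ?v" .
    then show ?thesis using Cons.IH[OF that] Cons.prems by (simp add: add.commute)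
  qed
  have "\<forall>\<^sub>F k in sequentially. iter_norm (?v + x s (\<phi> s k)) ?zs = g (\<phi> s k)"
    using \<phi>[OF s(1), unfolded filterlim_iff, rule_format, OF g(1)] by eventually_elim (rule IH)
  moreover have "(\<lambda>k. g (\<phi> s k)) \<longlonglongrightarrow> L" by (rule filterlim_compose[OF g(2) \<phi>[OF s(1)]])
  ultimately have "(\<lambda>k. iter_norm (?v + x s (\<phi> s k)) ?zs) \<longlonglongrightarrow> L"
    by (subst tendsto_cong)
  then show ?case by (simp add: ultra_Lim_eq tendsto_ultra)
qed simp

text \<open>
  Finitely many strict bounds on iterated norms are attained simultaneously by one choice of terms;
  this is where limits along an ultrafilter are better than limits superior.
\<close>

lemma iter_norm_choose_terms:
  assumes "distinct ss" "finite D" "\<And>d j. bounded (range (f d j))"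
    and "\<And>d. d \<in> D \<Longrightarrow> iter_norm (v d) (map (f d) ss) < B"
  shows "\<exists>\<phi>. (\<forall>j\<in>set ss. N \<le> \<phi> j) \<and> (\<forall>d\<in>D. norm (v d + (\<Sum>j\<in>set ss. f d j (\<phi> j))) < B)"
  using assms(1,4)
proof (induction ss arbitrary: v)
  case (Cons s ss)
  have "\<forall>\<^sub>F n in ultra. iter_norm (v d + f d s n) (map (f d) ss) < B" if "d \<in> D" for d
    using iter_norm_lim[of "f d s" "map (f d) ss" "v d"] assms(3) Cons.prems(2)[OF that]
    by (intro order_tendstoD(2)) auto
  then have "\<forall>\<^sub>F n in ultra. \<forall>d\<in>D. iter_norm (v d + f d s n) (map (f d) ss) < B"
    using assms(2) by (intro eventually_ball_finite) auto
  moreover have "\<forall>\<^sub>F n in ultra. N \<le> n" by (intro eventually_ultra eventually_ge_at_top)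
  ultimately have "\<forall>\<^sub>F n in ultra. N \<le> n \<and> (\<forall>d\<in>D. iter_norm (v d + f d s n) (map (f d) ss) < B)"
    by eventually_elim blast
  then obtain n where n: "N \<le> n" "\<And>d. d \<in> D \<Longrightarrow> iter_norm (v d + f d s n) (map (f d) ss) < B"
    using ultra_ex by blast
  have "distinct ss" using Cons.prems(1) by simp
  from Cons.IH[of "\<lambda>d. v d + f d s n", OF this n(2)] obtain \<phi> where
    \<phi>: "\<forall>j\<in>set ss. N \<le> \<phi> j" "\<forall>d\<in>D. norm (v d + f d s n + (\<Sum>j\<in>set ss. f d j (\<phi> j))) < B"
    by blast
  define \<psi> where "\<psi> = \<phi>(s := n)"
  have s: "s \<notin> set ss" using Cons.prems(1) by simp
  have "(\<Sum>j\<in>set (s # ss). f d j (\<psi> j)) = f d s n + (\<Sum>j\<in>set ss. f d j (\<phi> j))" for d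
  proof -
    have "(\<Sum>j\<in>set ss. f d j (\<psi> j)) = (\<Sum>j\<in>set ss. f d j (\<phi> j))"
      by (rule sum.cong) (use s in \<open>auto simp: \<psi>_def\<close>)
    then show ?thesis using s by (simp add: \<psi>_def)
  qed
  then have "\<forall>d\<in>D. norm (v d + (\<Sum>j\<in>set (s # ss). f d j (\<psi> j))) < B" using \<phi>(2) by (simp add: add.assoc)
  moreover have "\<forall>j\<in>set (s # ss). N \<le> \<psi> j" using \<phi>(1) n(1) by (auto simp: \<psi>_def)
  ultimately show ?case by blast
qed simp

lemma iter_norm_nonneg:
  assumes "\<And>z. z \<in> set zs \<Longrightarrow> bounded (range z)"
  shows "0 \<le> iter_norm v zs"
  using assms
proof (induction zs arbitrary: v)
  case (Cons z zs)
  show ?case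
    by (rule ultra_limit_le[OF tendsto_const iter_norm_lim]) (use Cons in auto)
qed simp

definition sign_of :: "'i set \<Rightarrow> 'i \<Rightarrow> real" where
  "sign_of A i = (if i \<in> A then 1 else - 1)"

text \<open>Split the sum according to the sign and suppress each half in turn.\<close>

lemma iter_norm_change_signs:
  assumes wn: "\<And>i. i \<in> set is \<Longrightarrow> weakly_null (f i)"
  shows "iter_norm 0 (map (\<lambda>i n. sign_of A i *\<^sub>R f i n) is) \<le> 2 * iter_norm 0 (map f is)"
proof -
  define g where "g B = (\<lambda>i n. if i \<in> B then f i n else 0)" for B
  have bd: "bounded (range (g B i))" if "i \<in> set is" for B i
    using wn[OF that] weakly_null_zero
    by (intro weakly_null_bounded) (cases "i \<in> B"; simp add: g_def)
  have eq: "(\<lambda>i n. sign_of A i *\<^sub>R f i n) = (\<lambda>i n. g A i n + (- 1) *\<^sub>R g (- A) i n)"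
    by (auto simp: fun_eq_iff sign_of_def g_def)
  have "iter_norm (0 + 0) (map (\<lambda>i n. sign_of A i *\<^sub>R f i n) is)
      \<le> iter_norm 0 (map (g A) is) + iter_norm 0 (map (\<lambda>i n. (- 1) *\<^sub>R g (- A) i n) is)"
    unfolding eq by (rule iter_norm_add) (use bd in \<open>auto intro: bounded_range_scaleR\<close>)
  also have "iter_norm 0 (map (\<lambda>i n. (- 1) *\<^sub>R g (- A) i n) is) = iter_norm 0 (map (g (- A)) is)"
    using iter_norm_scaleR[of "is" "g (- A)" "- 1" 0] bd by simp
  finally show ?thesis
    using iter_norm_suppress[of "is" f 0 A] iter_norm_suppress[of "is" f 0 "- A"] wn
    unfolding g_def by simp
qed

lemma sum_sign_of_mult:
  assumes ij: "i \<in> I" "j \<in> I" and I: "finite I"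
  shows "(\<Sum>A\<in>Pow I. sign_of A i * sign_of A j) = (if i = j then 2 ^ card I else 0)"
proof (cases "i = j")
  case True
  then have "(\<Sum>A\<in>Pow I. sign_of A i * sign_of A j) = (\<Sum>A\<in>Pow I. 1)"
    by (intro sum.cong) (auto simp: sign_of_def)
  then show ?thesis using True I by (simp add: card_Pow)
next
  case False
  define flip where "flip A = (if i \<in> A then A - {i} else insert i A)" for A
  \<comment> \<open>Flipping the sign of \<open>i\<close> alone is an involution that negates the summand.\<close>
  have "(\<Sum>A\<in>Pow I. sign_of A i * sign_of A j) = (\<Sum>A\<in>Pow I. - (sign_of A i * sign_of A j))"
    by (rule sum.reindex_bij_witness[of _ flip flip])
      (use ij False in \<open>auto simp: flip_def sign_of_def\<close>)
  then show ?thesis using False by (simp add: sum_negf)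
qed

text \<open>
  The diagonal \<open>\<Sum> z\<^sub>i(n\<^sub>i)\<close> of the matrix \<open>z\<^sub>j(n\<^sub>i)\<close> is the average of the \<open>\<Sum>\<^sub>i s\<^sub>i (\<Sum>\<^sub>j s\<^sub>j z\<^sub>j)(n\<^sub>i)\<close>
  over all signs \<open>s\<close>.
\<close>

lemma iter_norm_diagonal_le:
  fixes z :: "nat \<Rightarrow> nat \<Rightarrow> 'a::real_normed_vector"
  assumes z: "\<And>j. j < m \<Longrightarrow> weakly_null (z j)"
    and B: "\<And>A. A \<subseteq> {..<m} \<Longrightarrow>
      iter_norm 0 (map (\<lambda>i n. sign_of A i *\<^sub>R (\<Sum>j<m. sign_of A j *\<^sub>R z j n)) [0..<m]) \<le> B"
  shows "iter_norm 0 (map z [0..<m]) \<le> B"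
proof -
  let ?y = "\<lambda>A n. \<Sum>j<m. sign_of A j *\<^sub>R z j n"
  have wn: "weakly_null (\<lambda>n. sign_of A i *\<^sub>R ?y A n)" for A i
    by (intro weakly_null_scaleR weakly_null_sum z) auto
  have diag: "2 ^ m *\<^sub>R z i n = (\<Sum>A\<in>Pow {..<m}. sign_of A i *\<^sub>R ?y A n)" if "i < m" for i n
  proof -
    have "(\<Sum>A\<in>Pow {..<m}. sign_of A i *\<^sub>R ?y A n)
        = (\<Sum>j<m. (\<Sum>A\<in>Pow {..<m}. sign_of A i * sign_of A j) *\<^sub>R z j n)"
      unfolding scaleR_sum_right scaleR_sum_left scaleR_scaleR by (rule sum.swap)
    also have "\<dots> = (\<Sum>j<m. if j = i then 2 ^ m *\<^sub>R z j n else 0)"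
      by (rule sum.cong) (use that in \<open>auto simp: sum_sign_of_mult\<close>)
    also have "\<dots> = 2 ^ m *\<^sub>R z i n" using that by simp
    finally show ?thesis by simp
  qed
  have "2 ^ m * iter_norm 0 (map z [0..<m]) = iter_norm 0 (map (\<lambda>i n. 2 ^ m *\<^sub>R z i n) [0..<m])"
    using iter_norm_scaleR[of "[0..<m]" z "2 ^ m" 0] weakly_null_bounded[OF z] by simp
  also have "map (\<lambda>i n. 2 ^ m *\<^sub>R z i n) [0..<m]
      = map (\<lambda>i n. \<Sum>A\<in>Pow {..<m}. sign_of A i *\<^sub>R ?y A n) [0..<m]"
    by (rule map_cong) (auto simp: diag)
  also have "iter_norm 0 \<dots> \<le> (\<Sum>A\<in>Pow {..<m}. iter_norm 0 (map (\<lambda>i n. sign_of A i *\<^sub>R ?y A n) [0..<m]))"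
    by (rule iter_norm_sum) (auto intro: weakly_null_bounded[OF wn])
  also have "\<dots> \<le> (\<Sum>A\<in>Pow {..<m}. B)" by (rule sum_mono) (use B in auto)
  also have "\<dots> = 2 ^ m * B" by (simp add: card_Pow)
  finally show ?thesis by simp
qed

theorem theorem2p4:
  assumes "separable_space (euclidean :: 'a::banach topology)"
    and "\<And>(x :: nat \<Rightarrow> 'a) (xt :: nat \<Rightarrow> l_infinity).
           normalized x \<Longrightarrow> weakly_null x \<Longrightarrow> spreading_model xt x \<Longrightarrow>
           equivalent_sequences xt c0_unit"
  shows "weakly_asymptotically_symmetric TYPE('a)"
proof -
  have c0: "only_c0_spreading_models TYPE('a)"
    unfolding only_c0_spreading_models_def using assms(2) by blast
  obtain K where K: "\<And>(z :: nat \<Rightarrow> 'a) as. weakly_null z \<Longrightarrow> (\<And>n. norm (z n) \<le> 1) \<Longrightarrow>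
      (\<forall>a\<in>set as. \<bar>a\<bar> \<le> 1) \<Longrightarrow> iter_norm 0 (map (\<lambda>a n. a *\<^sub>R z n) as) \<le> K"
    using weakly_null_sums_uniformly_bounded[OF c0] by blast
  have "K \<ge> 0" using K[of "\<lambda>_. 0" "[]"] weakly_null_zero by simp
  have "L \<le> 2 * K * R"
    if wn: "\<forall>i<m. weakly_null (x i)" and \<sigma>: "\<sigma> permutes {..<m}"
      and L: "has_iterated_lim (\<lambda>n. norm (\<Sum>i<m. x i (n i))) [0..<m] (\<lambda>_. 0) L"
      and R: "has_iterated_lim (\<lambda>n. norm (\<Sum>i<m. x i (n i))) (map \<sigma> [0..<m]) (\<lambda>_. 0) R"
    for m and x :: "nat \<Rightarrow> nat \<Rightarrow> 'a" and \<sigma> L R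
  proof -
    define ss where "ss = map \<sigma> [0..<m]"
    have ss: "distinct ss" "set ss = {..<m}"
      using permutes_inj_on[OF \<sigma>] permutes_image[OF \<sigma>] by (auto simp: ss_def distinct_map atLeast0LessThan)
    have R_eq: "iter_norm 0 (map x ss) = R"
      using has_iterated_lim_iter_norm[OF R[folded ss_def], of "\<lambda>_ k. k"] ss by (simp add: filterlim_ident)
    have R0: "R \<ge> 0"
      unfolding R_eq[symmetric] by (rule iter_norm_nonneg) (use wn ss weakly_null_bounded in auto)
    have main: "L \<le> K * (2 * R + e)" if e: "e > 0" for e
    proof -
      define b where "b = 2 * R + e"
      have b: "b > 0" using R0 e by (simp add: b_def)
      define f where "f A j n = (if j < m then sign_of A j *\<^sub>R x j n else 0)" for A j n
      \<comment> \<open>In the order \<open>\<sigma>\<close> a change of signs at most doubles the limit \<open>R\<close>.\<close>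
      have "\<exists>\<phi>. (\<forall>j\<in>set ss. N \<le> \<phi> j) \<and> (\<forall>A\<in>Pow {..<m}. norm (0 + (\<Sum>j\<in>set ss. f A j (\<phi> j))) < b)" for N
      proof (rule iter_norm_choose_terms)
        have "weakly_null (f A j)" for A j
          using wn weakly_null_scaleR weakly_null_zero unfolding f_def by (cases "j < m") auto
        then show "bounded (range (f A j))" for A j by (rule weakly_null_bounded)
        show "iter_norm 0 (map (f A) ss) < b" for A
        proof -
          have "f A j = (\<lambda>n. sign_of A j *\<^sub>R x j n)" if "j \<in> set ss" for j
            using that unfolding ss(2) by (auto simp: f_def)
          then have "map (f A) ss = map (\<lambda>j n. sign_of A j *\<^sub>R x j n) ss"
            by (rule map_cong[OF refl])
          then have "iter_norm 0 (map (f A) ss) = iter_norm 0 (map (\<lambda>j n. sign_of A j *\<^sub>R x j n) ss)"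
            by (rule arg_cong)
          also have "\<dots> \<le> 2 * R"
            using iter_norm_change_signs[of ss x A] wn ss R_eq by simp
          finally have "iter_norm 0 (map (f A) ss) \<le> 2 * R" .
          then show ?thesis using e by (simp add: b_def)
        qed
      qed (use ss in auto)
      \<comment> \<open>One choice of terms must serve all signs, since the average over the signs is taken later.\<close>
      then have "\<exists>\<phi>. \<forall>N. (\<forall>j<m. N \<le> \<phi> N j) \<and> (\<forall>A\<in>Pow {..<m}. norm (\<Sum>j<m. f A j (\<phi> N j)) < b)"
        unfolding ss(2) add_0_left by (intro choice allI) (simp only: lessThan_iff Ball_def)
      then obtain \<phi> where \<phi>: "\<And>N j. j < m \<Longrightarrow> N \<le> \<phi> N j"
        "\<And>N A. A \<subseteq> {..<m} \<Longrightarrow> norm (\<Sum>j<m. f A j (\<phi> N j)) < b"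
        by blast
      have \<phi>_lim: "filterlim (\<lambda>N. \<phi> N j) sequentially sequentially" if "j < m" for j
        using \<phi>(1)[OF that] by (intro filterlim_at_top_mono[OF filterlim_ident]) simp
      define z where "z j N = x j (\<phi> N j)" for j N
      have zwn: "weakly_null (z j)" if "j < m" for j
        unfolding z_def by (rule weakly_null_compose[OF _ \<phi>_lim[OF that]]) (use wn that in simp)
      \<comment> \<open>Each signed row \<open>y\<close> below is one weakly null sequence of norm at most \<open>b\<close>, so \<open>K\<close> applies.\<close>
      have "iter_norm 0 (map z [0..<m]) \<le> K * b"
      proof (rule iter_norm_diagonal_le[OF zwn])
        fix A assume A: "A \<subseteq> {..<m}"
        define y where "y n = (\<Sum>j<m. sign_of A j *\<^sub>R z j n)" for n
        have ywn: "weakly_null y"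
          unfolding y_def by (intro weakly_null_sum weakly_null_scaleR zwn) auto
        have "norm (y n) < b" for n
          using \<phi>(2)[OF A, of n] by (simp add: y_def z_def f_def)
        then have y1: "norm (inverse b *\<^sub>R y n) \<le> 1" for n
          using b by (simp add: field_simps less_imp_le)
        let ?s = "map (sign_of A) [0..<m]"
        have "iter_norm 0 (map (\<lambda>a n. a *\<^sub>R y n) ?s)
            = b * iter_norm 0 (map (\<lambda>a n. a *\<^sub>R inverse b *\<^sub>R y n) ?s)"
          using iter_norm_scaleR[of ?s "\<lambda>a n. a *\<^sub>R inverse b *\<^sub>R y n" b 0] b
            weakly_null_bounded[OF weakly_null_scaleR[OF weakly_null_scaleR[OF ywn]]]
          by (simp add: mult.left_commute comp_def)
        also have "\<dots> \<le> b * K"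
          using b by (intro mult_left_mono K y1 weakly_null_scaleR ywn) (auto simp: sign_of_def)
        finally show "iter_norm 0 (map (\<lambda>i n. sign_of A i *\<^sub>R (\<Sum>j<m. sign_of A j *\<^sub>R z j n)) [0..<m])
            \<le> K * b"
          by (simp add: y_def comp_def mult.commute)
      qed
      moreover have "iter_norm 0 (map z [0..<m]) = L"
        using has_iterated_lim_iter_norm[OF L, of "\<lambda>j N. \<phi> N j"] \<phi>_lim
        unfolding z_def[abs_def] by (simp add: atLeast0LessThan)
      ultimately show ?thesis by (simp add: b_def)
    qed
    show ?thesis
    proof (rule field_le_epsilon)
      fix e :: real assume e: "e > 0"
      have "L \<le> K * (2 * R + e / (K + 1))" using e \<open>K \<ge> 0\<close> by (intro main) simp
      also have "\<dots> \<le> 2 * K * R + e" using e \<open>K \<ge> 0\<close> by (simp add: field_simps)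
      finally show "L \<le> 2 * K * R + e" .
    qed
  qed
  then show ?thesis unfolding weakly_asymptotically_symmetric_def by blast
qed

end
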